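(* Let $W=X(U\times I)$ be a world sheet in $\mathbb{R}^{n+1}_1$ and let $\widetilde H:U\times(LC^*\times I)\to\mathbb{R}$ be its family of extended lightcone height functions. Then $$\pi\bigl(\mathscr{L}_{\widetilde H}(\Sigma_*(\widetilde H))\bigr)=\mathbb{LP}(N_1(W))\subset LC^*\times I,$$ that is, the image of the unfolded lightcone pedal map of $W$ is the big wave front of the big Legendrian submanifold $\mathscr{L}_{\widetilde H}(\Sigma_*(\widetilde H))\subset PT^*(LC^*\times I)$.
   Context: Let $s\ge1$, $k\ge2$, $s+k=n+1$. $\mathbb{R}^{n+1}_1$ is $\mathbb{R}^{n+1}$ with $\langle x,y\rangle=-x_0y_0+\sum_{i=1}^nx_iy_i$. A nonzero $x$ is spacelike, lightlike, timelike if $\langle x,x\rangle>0,=0,<0$. Put $e_0=(1,0,\dots,0)$; a timelike $x$ is future directed if $\langle x,e_0\rangle<0$. $LC^*=\{x: x_0\neq0,\ \langle x,x\rangle=0\}$; for lightlike $x$, $\widetilde x=(1,x_1/x_0,\dots,x_n/x_0)$. World sheets: $U\subset\mathbb{R}^s$ is open, $I$ is an open interval, $X:U\times I\to\mathbb{R}^{n+1}_1$ is a smooth embedding, $W=X(U\times I)$, $\mathcal{S}_t=X(U\times\{t\})$. $W$ is a world sheet if every tangent space of $W$ is a timelike (Lorentzian) subspace, every nonzero tangent vector of each $\mathcal{S}_t$ is spacelike, and $W$ is time-orientable. $n^T(\bar u,t)$ is the unique future directed vector with $\langle n^T,n^T\rangle=-1$ that is tangent to $W$ and pseudo-orthogonal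 to $\mathcal{S}_t$ at $X(\bar u,t)$. $N_1(W)$ is the bundle over $W$ whose fiber at $p$ is the set of $\xi$ in the pseudo-normal space of $W$ at $p$ with $\langle\xi,\xi\rangle=1$. Put $\widetilde{\mathbb{LG}}(\mathcal{S}_t)((\bar u,t),\xi)=\widetilde{n^T(\bar u,t)+\xi}$ for $\xi\in N_1(W)_p$, $p=X(\bar u,t)$. The momentary lightcone pedal map is $\mathbb{LP}(\mathcal{S}_t)((\bar u,t),\xi)=\langle X(\bar u,t),\widetilde{\mathbb{LG}}(\mathcal{S}_t)((\bar u,t),\xi)\rangle\,\widetilde{\mathbb{LG}}(\mathcal{S}_t)((\bar u,t),\xi)$, understood as taking values in $LC^*$ (i.e. the scalar coefficient is nonzero), and the unfolded lightcone pedal map is $\mathbb{LP}:N_1(W)\to LC^*\times I$, $\mathbb{LP}((\bar u,t),\xi)=(\mathbb{LP}(\mathcal{S}_t)((\bar u,t),\xi),t)$. $\widetilde H((\bar u,t),v)=\langle X(\bar u,t),\widetilde v\rangle-v_0$, $v=(v_0,\dots,v_n)\in LC^*$. $\Sigma_*(\widetilde H)=\{(\bar u,v,t):\widetilde H=\partial\widetilde H/\partial u_1=\dots=\partial\widetilde H/\partial u_s=0\}$. In local coordinates $x$ on the $n$-manifold $LC^*$, $\mathscr{L}_{\widetilde H}(\bar u,v,t)=(v,t,[\partial\widetilde H/\partial x:\partial\widetilde H/\partial t])\in PT^*(LC^*\times I)$, where $PT^*(LC^*\times I)$ is the projective cotangent bundle with its canonical contact structure and projection $\pi:PT^*(LC^*\times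 I)\to LC^*\times I$. A big Legendrian submanifold is an $n$-dimensional (here: locally, i.e. germwise, embedded) integral submanifold $L$ of the contact structure, and its big wave front is $\pi(L)$. *)

theory Defs
  imports "HOL-Analysis.Analysis"
begin

section \<open>Smooth maps and immersions on open sets\<close>

text \<open>Only used for open \<^term>\<open>S\<close>: \<open>k\<close>-fold continuous differentiability, by recursion on directional
  derivatives, as in the AFP entry Smooth\_Manifolds.\<close>

primrec higher_differentiable_on ::
  "'a::real_normed_vector set \<Rightarrow> ('a \<Rightarrow> 'b::real_normed_vector) \<Rightarrow> nat \<Rightarrow> bool" where
  "higher_differentiable_on S f 0 \<longleftrightarrow> continuous_on S f"
| "higher_differentiable_on S f (Suc k) \<longleftrightarrow>
     (\<forall>x\<in>S. f differentiable (at x)) \<and>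
     (\<forall>w. higher_differentiable_on S (\<lambda>x. frechet_derivative f (at x) w) k)"

definition smooth_on ::
  "'a::real_normed_vector set \<Rightarrow> ('a \<Rightarrow> 'b::real_normed_vector) \<Rightarrow> bool" where
  "smooth_on S f \<longleftrightarrow> (\<forall>k. higher_differentiable_on S f k)"

definition smooth_embedding_on ::
  "'a::real_normed_vector set \<Rightarrow> ('a \<Rightarrow> 'b::real_normed_vector) \<Rightarrow> bool" where
  "smooth_embedding_on S f \<longleftrightarrow>
     smooth_on S f \<and> (\<forall>x\<in>S. inj (frechet_derivative f (at x))) \<and>
     (\<exists>g. homeomorphism S (f ` S) f g)"


section \<open>Lorentz-Minkowski space\<close>

text \<open>A vector \<open>(x\<^sub>0, x\<^sub>1, \<dots>, x\<^sub>n)\<close> is the pair of \<open>x\<^sub>0\<close> and \<open>(x\<^sub>1, \<dots>, x\<^sub>n)\<close>, where \<open>n = CARD('n)\<close>.\<close>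

type_synonym 'n mink = "real \<times> (real ^ 'n)"

definition lprod :: "'n::finite mink \<Rightarrow> 'n mink \<Rightarrow> real" where
  "lprod x y = - (fst x * fst y) + (\<Sum>i\<in>UNIV. snd x $ i * snd y $ i)"

definition spacelike :: "'n::finite mink \<Rightarrow> bool" where
  "spacelike x \<longleftrightarrow> x \<noteq> 0 \<and> lprod x x > 0"

definition timelike :: "'n::finite mink \<Rightarrow> bool" where
  "timelike x \<longleftrightarrow> x \<noteq> 0 \<and> lprod x x < 0"

definition future_directed :: "'n::finite mink \<Rightarrow> bool" where
  "future_directed x \<longleftrightarrow> timelike x \<and> lprod x (1, 0) < 0"

text \<open>The induced form is nondegenerate of index one.\<close>

definition lorentzian_subspace :: "'n::finite mink set \<Rightarrow> bool" where
  "lorentzian_subspace V \<longleftrightarrow> subspace V \<and>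
     (\<exists>e\<in>V. timelike e \<and> (\<forall>x\<in>V. lprod x e = 0 \<and> x \<noteq> 0 \<longrightarrow> spacelike x))"

definition LC :: "'n::finite mink set" where
  "LC = {x. fst x \<noteq> 0 \<and> lprod x x = 0}"

definition ltilde :: "'n::finite mink \<Rightarrow> 'n mink" where
  "ltilde x = (1, \<chi> i. snd x $ i / fst x)"


section \<open>World sheets\<close>

text \<open>Since \<open>X\<close> is an embedding, points of \<open>W = X(U \<times> I)\<close> are named by their parameters \<open>(u, t)\<close>, and
  vector fields and bundles on \<open>W\<close> are indexed by \<open>U \<times> I\<close>.\<close>

definition tangent_W :: "((real ^ 's::finite) \<times> real \<Rightarrow> 'n::finite mink) \<Rightarrow>
    (real ^ 's) \<times> real \<Rightarrow> 'n mink set" where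
  "tangent_W X z = range (frechet_derivative X (at z))"

definition tangent_S :: "((real ^ 's::finite) \<times> real \<Rightarrow> 'n::finite mink) \<Rightarrow>
    (real ^ 's) \<times> real \<Rightarrow> 'n mink set" where
  "tangent_S X z = range (frechet_derivative (\<lambda>u. X (u, snd z)) (at (fst z)))"

definition time_orientable :: "((real ^ 's::finite) \<times> real \<Rightarrow> 'n::finite mink) \<Rightarrow>
    (real ^ 's) set \<Rightarrow> real set \<Rightarrow> bool" where
  "time_orientable X U I \<longleftrightarrow>
     (\<exists>T. smooth_on (U \<times> I) T \<and> (\<forall>z\<in>U \<times> I. T z \<in> tangent_W X z \<and> timelike (T z)))"

definition world_sheet :: "((real ^ 's::finite) \<times> real \<Rightarrow> 'n::finite mink) \<Rightarrow>
    (real ^ 's) set \<Rightarrow> real set \<Rightarrow> bool" where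
  "world_sheet X U I \<longleftrightarrow>
     open U \<and> open I \<and> is_interval I \<and> smooth_embedding_on (U \<times> I) X \<and>
     (\<forall>z\<in>U \<times> I. lorentzian_subspace (tangent_W X z)) \<and>
     (\<forall>z\<in>U \<times> I. \<forall>x\<in>tangent_S X z. x \<noteq> 0 \<longrightarrow> spacelike x) \<and>
     time_orientable X U I"

definition nT :: "((real ^ 's::finite) \<times> real \<Rightarrow> 'n::finite mink) \<Rightarrow>
    (real ^ 's) \<times> real \<Rightarrow> 'n mink" where
  "nT X z = (THE e. future_directed e \<and> lprod e e = -1 \<and> e \<in> tangent_W X z \<and>
                    (\<forall>x\<in>tangent_S X z. lprod e x = 0))"

definition normal_W :: "((real ^ 's::finite) \<times> real \<Rightarrow> 'n::finite mink) \<Rightarrow>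
    (real ^ 's) \<times> real \<Rightarrow> 'n mink set" where
  "normal_W X z = {\<xi>. \<forall>x\<in>tangent_W X z. lprod \<xi> x = 0}"

definition N1 :: "((real ^ 's::finite) \<times> real \<Rightarrow> 'n::finite mink) \<Rightarrow>
    (real ^ 's) set \<Rightarrow> real set \<Rightarrow> (((real ^ 's) \<times> real) \<times> 'n mink) set" where
  "N1 X U I = {(z, \<xi>). z \<in> U \<times> I \<and> \<xi> \<in> normal_W X z \<and> lprod \<xi> \<xi> = 1}"


section \<open>Lightcone pedal maps\<close>

definition LG :: "((real ^ 's::finite) \<times> real \<Rightarrow> 'n::finite mink) \<Rightarrow>
    ((real ^ 's) \<times> real) \<times> 'n mink \<Rightarrow> 'n mink" where
  "LG X q = ltilde (nT X (fst q) + snd q)"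

definition pedal_coeff :: "((real ^ 's::finite) \<times> real \<Rightarrow> 'n::finite mink) \<Rightarrow>
    ((real ^ 's) \<times> real) \<times> 'n mink \<Rightarrow> real" where
  "pedal_coeff X q = lprod (X (fst q)) (LG X q)"

definition momentary_pedal :: "((real ^ 's::finite) \<times> real \<Rightarrow> 'n::finite mink) \<Rightarrow>
    ((real ^ 's) \<times> real) \<times> 'n mink \<Rightarrow> 'n mink" where
  "momentary_pedal X q = pedal_coeff X q *\<^sub>R LG X q"

definition unfolded_pedal :: "((real ^ 's::finite) \<times> real \<Rightarrow> 'n::finite mink) \<Rightarrow>
    ((real ^ 's) \<times> real) \<times> 'n mink \<Rightarrow> 'n mink \<times> real" where
  "unfolded_pedal X q = (momentary_pedal X q, snd (fst q))"


section \<open>The projective cotangent bundle of \<open>LC \<times> I\<close>\<close>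

text \<open>On each of its two components, \<^term>\<open>LC\<close> is the graph of \<open>x\<^sub>0 = \<plusminus>norm (x\<^sub>1, \<dots>, x\<^sub>n)\<close> over
  the nonzero vectors \<open>(x\<^sub>1, \<dots>, x\<^sub>n)\<close>, so \<open>x\<^sub>1, \<dots>, x\<^sub>n\<close> are local coordinates around each point of
  \<^term>\<open>LC\<close>. In them a covector \<open>\<Sum> p\<^sub>i dx\<^sub>i + \<tau> dt\<close> at a point of \<open>LC \<times> I\<close> is the pair
  \<open>(p, \<tau>)\<close>.\<close>

definition lc_chart_inv :: "real \<Rightarrow> real ^ 'n::finite \<Rightarrow> 'n mink" where
  "lc_chart_inv \<epsilon> x = (\<epsilon> * norm x, x)"

lemma lprod_self: "lprod x x = (norm (snd x))\<^sup>2 - (fst x)\<^sup>2"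
  unfolding power2_norm_eq_inner by (simp add: lprod_def inner_vec_def power2_eq_square)

lemma LC_eq_graphs:
  "LC = (\<Union>\<epsilon>\<in>{1, -1}. lc_chart_inv \<epsilon> ` (UNIV - {0}))"
proof -
  have "v \<in> LC \<longleftrightarrow> (\<exists>\<epsilon>\<in>{1, -1}. fst v = \<epsilon> * norm (snd v)) \<and> snd v \<noteq> 0" for v :: "'a mink"
    by (auto simp: LC_def lprod_self power2_eq_iff)
  then show ?thesis
    by (fastforce simp: lc_chart_inv_def image_iff)
qed

lemma lc_chart_inv_snd:
  assumes "v \<in> LC"
  shows "lc_chart_inv (sgn (fst v)) (snd v) = v"
  using assms unfolding LC_eq_graphs lc_chart_inv_def by (auto simp: sgn_mult)

type_synonym 'n covec = "(real ^ 'n) \<times> real"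
type_synonym 'n pt_point = "('n mink \<times> real) \<times> 'n covec set"

text \<open>The value of a covector on a tangent vector \<open>(w, r)\<close> of \<open>LC \<times> I\<close>, where
  \<open>w\<close> is tangent to \<^term>\<open>LC\<close> and \<open>dx\<^sub>i w = snd w $ i\<close>.\<close>

definition covec_apply :: "'n::finite covec \<Rightarrow> 'n mink \<times> real \<Rightarrow> real" where
  "covec_apply \<alpha> w = (\<Sum>i\<in>UNIV. fst \<alpha> $ i * snd (fst w) $ i) + snd \<alpha> * snd w"

definition proj_class :: "'n::finite covec \<Rightarrow> 'n covec set" where
  "proj_class \<alpha> = span {\<alpha>}"

definition PT :: "real set \<Rightarrow> 'n::finite pt_point set" where
  "PT I = {(m, proj_class \<alpha>) | m \<alpha>. m \<in> LC \<times> I \<and> \<alpha> \<noteq> 0}"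

text \<open>Quotient topology from the cotangent bundle without its zero section.\<close>

definition pt_topology :: "real set \<Rightarrow> 'n::finite pt_point topology" where
  "pt_topology I = topology (\<lambda>S. S \<subseteq> PT I \<and>
     openin (top_of_set ((LC \<times> I) \<times> (UNIV - {0})))
       {(m, \<alpha>). m \<in> LC \<times> I \<and> \<alpha> \<noteq> 0 \<and> (m, proj_class \<alpha>) \<in> S})"


section \<open>Big Legendrian submanifolds\<close>

text \<open>An embedded integral \<open>n\<close>-dimensional patch \<open>y \<mapsto> (m y, [\<alpha> y])\<close>, \<open>y\<close> in an open subset of
  \<open>\<real>\<^sup>n\<close>, given by a smooth lift \<open>(m, \<alpha>)\<close> to the cotangent bundle without its zero section; every
  smooth map into the projective cotangent bundle has such lifts locally. The tangent space of a
  projective space at \<open>[\<alpha>]\<close> is the quotient by the line of \<open>\<alpha>\<close>, whence the form of the immersion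
  condition. The contact hyperplane at \<open>(m, [\<alpha>])\<close> consists of the tangent vectors whose image under
  the differential of the projection to \<open>LC \<times> I\<close> is annihilated by \<open>\<alpha>\<close>.\<close>

definition legendrian_patch :: "real set \<Rightarrow> (real ^ 'n::finite) set \<Rightarrow>
    (real ^ 'n \<Rightarrow> 'n mink \<times> real) \<Rightarrow> (real ^ 'n \<Rightarrow> 'n covec) \<Rightarrow> bool" where
  "legendrian_patch I B m \<alpha> \<longleftrightarrow>
     open B \<and> smooth_on B m \<and> smooth_on B \<alpha> \<and>
     (\<forall>y\<in>B. m y \<in> LC \<times> I \<and> \<alpha> y \<noteq> 0) \<and>
     (\<forall>y\<in>B. \<forall>w. frechet_derivative m (at y) w = 0 \<and>
                frechet_derivative \<alpha> (at y) w \<in> span {\<alpha> y} \<longrightarrow> w = 0) \<and>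
     embedding_map (top_of_set B) (pt_topology I) (\<lambda>y. (m y, proj_class (\<alpha> y))) \<and>
     (\<forall>y\<in>B. \<forall>w. covec_apply (\<alpha> y) (frechet_derivative m (at y) w) = 0)"

definition legendrian_submanifold :: "real set \<Rightarrow> 'n::finite pt_point set \<Rightarrow> bool" where
  "legendrian_submanifold I L \<longleftrightarrow> L \<subseteq> PT I \<and>
     (\<forall>l\<in>L. \<exists>B m \<alpha>. legendrian_patch I B m \<alpha> \<and>
        l \<in> (\<lambda>y. (m y, proj_class (\<alpha> y))) ` B \<and>
        openin (subtopology (pt_topology I) L) ((\<lambda>y. (m y, proj_class (\<alpha> y))) ` B))"

text \<open>The image \<open>f ` S\<close>, whose germs are those of \<open>f\<close> at the points of \<open>S\<close>: globally \<open>f ` S\<close> may have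
  self-intersections.\<close>

definition big_legendrian :: "real set \<Rightarrow> ('a::topological_space \<Rightarrow> 'n::finite pt_point) \<Rightarrow>
    'a set \<Rightarrow> bool" where
  "big_legendrian I f S \<longleftrightarrow>
     (\<forall>\<sigma>\<in>S. \<exists>V. open V \<and> \<sigma> \<in> V \<and>
        embedding_map (top_of_set (S \<inter> V)) (pt_topology I) f \<and>
        legendrian_submanifold I (f ` (S \<inter> V)))"

definition pt_proj :: "'n::finite pt_point \<Rightarrow> 'n mink \<times> real" where
  "pt_proj = fst"


section \<open>Extended lightcone height functions\<close>

definition height :: "((real ^ 's::finite) \<times> real \<Rightarrow> 'n::finite mink) \<Rightarrow>
    (real ^ 's) \<times> real \<Rightarrow> 'n mink \<Rightarrow> real" where
  "height X z v = lprod (X z) (ltilde v) - fst v"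

definition height_du :: "((real ^ 's::finite) \<times> real \<Rightarrow> 'n::finite mink) \<Rightarrow>
    's \<Rightarrow> (real ^ 's) \<times> real \<Rightarrow> 'n mink \<Rightarrow> real" where
  "height_du X i z v =
     frechet_derivative (\<lambda>u. height X (u, snd z) v) (at (fst z)) (axis i 1)"

definition height_dx :: "((real ^ 's::finite) \<times> real \<Rightarrow> 'n::finite mink) \<Rightarrow>
    'n \<Rightarrow> (real ^ 's) \<times> real \<Rightarrow> 'n mink \<Rightarrow> real" where
  "height_dx X i z v =
     frechet_derivative (\<lambda>x. height X z (lc_chart_inv (sgn (fst v)) x)) (at (snd v)) (axis i 1)"

definition height_dt :: "((real ^ 's::finite) \<times> real \<Rightarrow> 'n::finite mink) \<Rightarrow>
    (real ^ 's) \<times> real \<Rightarrow> 'n mink \<Rightarrow> real" where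
  "height_dt X z v = deriv (\<lambda>t. height X (fst z, t) v) (snd z)"

definition Sigma_star :: "((real ^ 's::finite) \<times> real \<Rightarrow> 'n::finite mink) \<Rightarrow>
    (real ^ 's) set \<Rightarrow> real set \<Rightarrow> ((real ^ 's) \<times> 'n mink \<times> real) set" where
  "Sigma_star X U I = {(u, v, t). u \<in> U \<and> v \<in> LC \<and> t \<in> I \<and>
     height X (u, t) v = 0 \<and> (\<forall>i. height_du X i (u, t) v = 0)}"

definition legendrian_lift :: "((real ^ 's::finite) \<times> real \<Rightarrow> 'n::finite mink) \<Rightarrow>
    (real ^ 's) \<times> 'n mink \<times> real \<Rightarrow> 'n pt_point" where
  "legendrian_lift X = (\<lambda>(u, v, t).
     ((v, t), proj_class (\<chi> i. height_dx X i (u, t) v, height_dt X (u, t) v)))"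

end

theory Submission
  imports Defs
begin

text \<open>
  Both sides of the front equation describe null lines orthogonal to a slice. The equations of
  \<^term>\<open>Sigma_star X U I\<close> say that \<open>ltilde v\<close> is a null vector orthogonal to the slice at
  \<open>X (u, t)\<close> and that \<open>v\<^sub>0 = lprod (X (u, t)) (ltilde v)\<close>, so that \<open>v\<close> is recovered from its
  direction \<open>ltilde v\<close>. A nonzero null vector is never orthogonal to the timelike \<open>nT\<close>; rescaled to
  \<open>lprod nT l = -1\<close> it has the form \<open>l = nT + \<xi>\<close> with a unit normal \<open>\<xi>\<close> of the world sheet, and
  conversely every \<open>nT + \<xi>\<close> is null and orthogonal to the slice
  (\<open>null_normal_imp_N1\<close>, \<open>N1_imp_null_normal\<close>, \<open>front_eq_pedal_image\<close>). A pedal point with zero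
  coefficient is the origin, which lies outside the cone; hence the intersection with \<open>LC \<times> I\<close>.

  The Legendrian part is the argument for generating families, made explicit. In the chart \<open>x\<close>
  of a component of the cone put \<open>ltilde v = (1, \<omega>)\<close>. The equations \<open>height = 0\<close>, \<open>height_du = 0\<close>
  have a surjective differential already in the \<open>x\<close>-directions, because a tangent vector of the
  slice that is orthogonal to \<open>(1, \<omega>)\<close> and has spatial part parallel to \<open>\<omega>\<close> would be null
  (\<open>surj_der_height_constraint\<close>). Completing the equations by linear coordinates to a local
  diffeomorphism parametrizes their zero set locally by an open subset of \<open>\<real>\<^sup>n\<close>. Along it the height and
  its \<open>u\<close>-derivatives vanish, so differentiating \<open>height = 0\<close> leaves the contact condition
  (\<open>patch_contact\<close>). A direction killed by the lift keeps \<open>(v, t)\<close> fixed and moves \<open>X (u, t)\<close> along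
  \<open>(1, \<omega>)\<close> only, again a null tangent of the slice; so the lift is an immersion
  (\<open>patch_immersion\<close>).

  Passing to the projective bundle loses nothing: on the zero set the covector \<open>d height\<close> takes the
  value \<open>- v\<^sub>0 \<noteq> 0\<close> on the radial tangent vector \<open>v\<close>, so it can be recovered continuously from its
  class (\<open>embedding_map_projectivization\<close>). The local diffeomorphisms come from a smooth version of
  the inverse function theorem (\<open>smooth_inverse_function\<close>), which serves twice: for the zero set,
  and to see that an immersion is locally an embedding.
\<close>

section \<open>Calculus of smooth maps\<close>

abbreviation D :: "('a::real_normed_vector \<Rightarrow> 'b::real_normed_vector) \<Rightarrow> 'a \<Rightarrow> 'a \<Rightarrow> 'b" where
  "D f x \<equiv> frechet_derivative f (at x)"

lemma higher_differentiable_on_Suc_has_derivative: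
  "higher_differentiable_on S f (Suc k) \<Longrightarrow> x \<in> S \<Longrightarrow> (f has_derivative D f x) (at x)"
  by (simp add: frechet_derivative_works[symmetric])

lemma higher_differentiable_on_Suc_derivative:
  "higher_differentiable_on S f (Suc k) \<Longrightarrow> higher_differentiable_on S (\<lambda>x. D f x w) k"
  by simp

declare higher_differentiable_on.simps(2) [simp del]

lemma higher_differentiable_on_cong:
  assumes "open S" "\<And>x. x \<in> S \<Longrightarrow> f x = g x" "higher_differentiable_on S f k"
  shows "higher_differentiable_on S g k"
  using assms(2,3)
proof (induction k arbitrary: f g)
  case 0
  then show ?case by (simp cong: continuous_on_cong)
next
  case (Suc k)
  have der: "(g has_derivative D f x) (at x)" if "x \<in> S" for x
    using has_derivative_transform_within_open
      [OF higher_differentiable_on_Suc_has_derivative[OF Suc.prems(2) that] assms(1) that]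
      Suc.prems(1) by blast
  then have eq: "D f x = D g x" if "x \<in> S" for x
    using that frechet_derivative_at by blast
  have "higher_differentiable_on S (\<lambda>x. D g x w) k" for w
    by (rule Suc.IH[OF _ higher_differentiable_on_Suc_derivative[OF Suc.prems(2)]]) (simp add: eq)
  then show ?case
    using der by (auto simp: higher_differentiable_on.simps(2) intro: differentiableI)
qed

lemma higher_differentiable_on_SucI:
  assumes "open S" "\<And>x. x \<in> S \<Longrightarrow> (f has_derivative f' x) (at x)"
    "\<And>w. higher_differentiable_on S (\<lambda>x. f' x w) k"
  shows "higher_differentiable_on S f (Suc k)"
proof -
  have "f' x = D f x" if "x \<in> S" for x
    using assms(2) that frechet_derivative_at by blast
  then have "higher_differentiable_on S (\<lambda>x. D f x w) k" for w
    by (intro higher_differentiable_on_cong[OF assms(1) _ assms(3)]) auto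
  then show ?thesis
    using assms(2) by (auto simp: higher_differentiable_on.simps(2) intro: differentiableI)
qed

lemma higher_differentiable_on_SucD:
  "higher_differentiable_on S f (Suc k) \<Longrightarrow> higher_differentiable_on S f k"
proof (induction k arbitrary: f)
  case 0
  then have "continuous_on S f"
    by (meson continuous_at_imp_continuous_on has_derivative_continuous
        higher_differentiable_on_Suc_has_derivative)
  then show ?case by simp
next
  case (Suc k)
  have "higher_differentiable_on S (\<lambda>x. D f x w) k" for w
    by (intro Suc.IH higher_differentiable_on_Suc_derivative Suc.prems)
  then show ?case
    using Suc.prems by (simp add: higher_differentiable_on.simps(2)[of _ f])
qed

lemma higher_differentiable_on_const:
  "higher_differentiable_on S (\<lambda>x. c) k"
  by (induction k arbitrary: c) (simp_all add: higher_differentiable_on.simps(2))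

lemma higher_differentiable_on_add:
  assumes "open S" "higher_differentiable_on S f k" "higher_differentiable_on S g k"
  shows "higher_differentiable_on S (\<lambda>x. f x + g x) k"
  using assms(2,3)
proof (induction k arbitrary: f g)
  case 0
  then show ?case by (simp add: continuous_on_add)
next
  case (Suc k)
  note df = higher_differentiable_on_Suc_has_derivative[OF Suc.prems(1)]
  note dg = higher_differentiable_on_Suc_has_derivative[OF Suc.prems(2)]
  show ?case
    using Suc.prems
    by (intro higher_differentiable_on_SucI[OF assms(1) has_derivative_add[OF df dg]] Suc.IH
        higher_differentiable_on_Suc_derivative)
qed

lemma higher_differentiable_on_sum:
  assumes "open S" "\<And>i. i \<in> A \<Longrightarrow> higher_differentiable_on S (f i) k"
  shows "higher_differentiable_on S (\<lambda>x. \<Sum>i\<in>A. f i x) k"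
  using assms(2)
  by (induction A rule: infinite_finite_induct)
     (simp_all add: higher_differentiable_on_const higher_differentiable_on_add assms(1))

lemma higher_differentiable_on_linear:
  assumes "open S" "bounded_linear L" "higher_differentiable_on S f k"
  shows "higher_differentiable_on S (\<lambda>x. L (f x)) k"
  using assms(3)
proof (induction k arbitrary: f)
  case 0
  then show ?case by (simp add: bounded_linear.continuous_on[OF assms(2)])
next
  case (Suc k)
  note df = higher_differentiable_on_Suc_has_derivative[OF Suc.prems(1)]
  show ?case
    using Suc.prems
    by (intro higher_differentiable_on_SucI[OF assms(1) bounded_linear.has_derivative[OF assms(2) df]]
        Suc.IH higher_differentiable_on_Suc_derivative)
qed

lemma higher_differentiable_on_bilinear:
  assumes "open S" "bounded_bilinear b"
    "higher_differentiable_on S f k" "higher_differentiable_on S g k"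
  shows "higher_differentiable_on S (\<lambda>x. b (f x) (g x)) k"
  using assms(3,4)
proof (induction k arbitrary: f g)
  case 0
  then show ?case by (auto intro: bounded_bilinear.continuous_on[OF assms(2)])
next
  case (Suc k)
  note df = higher_differentiable_on_Suc_has_derivative[OF Suc.prems(1)]
  note dg = higher_differentiable_on_Suc_has_derivative[OF Suc.prems(2)]
  note low = Suc.prems[THEN higher_differentiable_on_SucD]
  show ?case
    using Suc.prems
    by (intro higher_differentiable_on_SucI[OF assms(1) bounded_bilinear.FDERIV[OF assms(2) df dg]]
        higher_differentiable_on_add assms(1) Suc.IH low higher_differentiable_on_Suc_derivative)
qed

lemma linear_euclidean_expansion:
  fixes f :: "'a::euclidean_space \<Rightarrow> 'b::real_vector"
  assumes "linear f"
  shows "f v = (\<Sum>b\<in>Basis. (v \<bullet> b) *\<^sub>R f b)"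
proof -
  have "f v = f (\<Sum>b\<in>Basis. (v \<bullet> b) *\<^sub>R b)"
    by (simp only: euclidean_representation)
  also have "\<dots> = (\<Sum>b\<in>Basis. (v \<bullet> b) *\<^sub>R f b)"
    by (simp only: linear_sum[OF assms] linear_scale[OF assms])
  finally show ?thesis .
qed

text \<open>The chain rule expands \<open>D g\<close> in a basis of the middle space: only directional derivatives in
  fixed directions are covered by the induction hypothesis.\<close>

lemma higher_differentiable_on_compose:
  fixes f :: "'a::real_normed_vector \<Rightarrow> 'b::euclidean_space"
  assumes "open S" "open T" "f ` S \<subseteq> T"
    "higher_differentiable_on S f k" "higher_differentiable_on T g k"
  shows "higher_differentiable_on S (\<lambda>x. g (f x)) k"
  using assms(4,5)
proof (induction k arbitrary: g)
  case 0
  then show ?case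
    using assms(3) by (auto intro: continuous_on_compose2)
next
  case (Suc k)
  note df = higher_differentiable_on_Suc_has_derivative[OF Suc.prems(1)]
    and dg = higher_differentiable_on_Suc_has_derivative[OF Suc.prems(2)]
  have fT: "f x \<in> T" if "x \<in> S" for x
    using assms(3) that by auto
  have lin: "D g (f x) v = (\<Sum>b\<in>Basis. (v \<bullet> b) *\<^sub>R D g (f x) b)" if "x \<in> S" for x v
  proof -
    have "linear (D g (f x))"
      using dg[OF fT[OF that]] by (rule has_derivative_linear)
    then show ?thesis by (rule linear_euclidean_expansion)
  qed
  have der: "((\<lambda>x. g (f x)) has_derivative
      (\<lambda>w. \<Sum>b\<in>Basis. (D f x w \<bullet> b) *\<^sub>R D g (f x) b)) (at x)" if "x \<in> S" for x
    by (rule has_derivative_eq_rhs[OF has_derivative_compose[OF df[OF that] dg[OF fT[OF that]]]])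
       (rule ext, rule lin[OF that])
  have "higher_differentiable_on S (\<lambda>x. D f x w \<bullet> b) k" for w b
    by (rule higher_differentiable_on_linear[OF assms(1) bounded_linear_inner_left
          higher_differentiable_on_Suc_derivative[OF Suc.prems(1)]])
  moreover have "higher_differentiable_on S (\<lambda>x. D g (f x) b) k" for b
    by (rule Suc.IH[OF higher_differentiable_on_SucD[OF Suc.prems(1)]
          higher_differentiable_on_Suc_derivative[OF Suc.prems(2)]])
  ultimately have "higher_differentiable_on S (\<lambda>x. (D f x w \<bullet> b) *\<^sub>R D g (f x) b) k" for w b
    by (rule higher_differentiable_on_bilinear[OF assms(1) bounded_bilinear_scaleR])
  then have "higher_differentiable_on S (\<lambda>x. \<Sum>b\<in>Basis. (D f x w \<bullet> b) *\<^sub>R D g (f x) b) k" for w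
    by (rule higher_differentiable_on_sum[OF assms(1)])
  from higher_differentiable_on_SucI[OF assms(1) der this] show ?case .
qed

lemma higher_differentiable_on_inverse:
  fixes f :: "'a::real_normed_vector \<Rightarrow> real"
  assumes "open S" "\<And>x. x \<in> S \<Longrightarrow> f x \<noteq> 0" "higher_differentiable_on S f k"
  shows "higher_differentiable_on S (\<lambda>x. inverse (f x)) k"
  using assms(3)
proof (induction k)
  case 0
  then show ?case using assms(2) by (simp add: continuous_on_inverse)
next
  case (Suc k)
  note df = higher_differentiable_on_Suc_has_derivative[OF Suc.prems]
  show ?case
    using Suc.prems
    by (intro higher_differentiable_on_SucI[OF assms(1) Deriv.has_derivative_inverse[OF assms(2) df]]
        higher_differentiable_on_linear[OF assms(1) bounded_linear_minus[OF bounded_linear_ident]]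
        higher_differentiable_on_bilinear[OF assms(1) bounded_bilinear_mult]
        Suc.IH[OF higher_differentiable_on_SucD] higher_differentiable_on_Suc_derivative)
qed

lemma higher_differentiable_on_sqrt:
  fixes f :: "'a::real_normed_vector \<Rightarrow> real"
  assumes "open S" "\<And>x. x \<in> S \<Longrightarrow> f x > 0" "higher_differentiable_on S f k"
  shows "higher_differentiable_on S (\<lambda>x. sqrt (f x)) k"
  using assms(3)
proof (induction k)
  case 0
  then show ?case by (simp add: continuous_on_real_sqrt)
next
  case (Suc k)
  have der: "((\<lambda>x. sqrt (f x)) has_derivative
      (\<lambda>w. D f x w * (inverse (2 * sqrt (f x))))) (at x)" if "x \<in> S" for x
    using has_derivative_real_sqrt[OF assms(2)[OF that]
        higher_differentiable_on_Suc_has_derivative[OF Suc.prems that]]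
    by (simp add: field_simps)
  have nz: "2 * sqrt (f x) \<noteq> 0" if "x \<in> S" for x
    using assms(2)[OF that] by simp
  show ?case
    using Suc.prems
    by (intro higher_differentiable_on_SucI[OF assms(1) der] nz
        higher_differentiable_on_bilinear[OF assms(1) bounded_bilinear_mult]
        higher_differentiable_on_inverse higher_differentiable_on_const assms(1)
        Suc.IH[OF higher_differentiable_on_SucD] higher_differentiable_on_Suc_derivative)
qed

lemma smooth_onD: "smooth_on S f \<Longrightarrow> higher_differentiable_on S f k"
  by (simp add: smooth_on_def)

lemma smooth_on_subset:
  assumes "smooth_on S f" "T \<subseteq> S"
  shows "smooth_on T f"
proof -
  have "higher_differentiable_on S f k \<Longrightarrow> higher_differentiable_on T f k" for k
    by (induction k arbitrary: f)
       (use assms(2) in \<open>auto intro: continuous_on_subset simp: higher_differentiable_on.simps(2)\<close>)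
  with assms(1) show ?thesis by (auto simp: smooth_on_def)
qed

lemma smooth_on_imp_has_derivative:
  assumes "smooth_on S f" "x \<in> S"
  shows "(f has_derivative D f x) (at x)"
  by (rule higher_differentiable_on_Suc_has_derivative[OF smooth_onD[OF assms(1)] assms(2)])

lemma smooth_on_imp_continuous_on:
  assumes "smooth_on S f"
  shows "continuous_on S f"
  using smooth_onD[OF assms, of 0] by simp

lemma smooth_on_frechet_derivative:
  assumes "smooth_on S f"
  shows "smooth_on S (\<lambda>x. D f x w)"
  unfolding smooth_on_def
proof
  show "higher_differentiable_on S (\<lambda>x. D f x w) k" for k
    by (rule higher_differentiable_on_Suc_derivative[OF smooth_onD[OF assms]])
qed

lemma smooth_on_linear:
  assumes "open S" "bounded_linear L" "smooth_on S f"
  shows "smooth_on S (\<lambda>x. L (f x))"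
  unfolding smooth_on_def
  by (intro allI higher_differentiable_on_linear[OF assms(1,2) smooth_onD[OF assms(3)]])

lemma smooth_on_compose:
  fixes f :: "'a::real_normed_vector \<Rightarrow> 'b::euclidean_space"
  assumes "open S" "open T" "f ` S \<subseteq> T" "smooth_on S f" "smooth_on T g"
  shows "smooth_on S (\<lambda>x. g (f x))"
  unfolding smooth_on_def
  by (intro allI higher_differentiable_on_compose[OF assms(1-3) smooth_onD[OF assms(4)]
        smooth_onD[OF assms(5)]])

lemma smooth_on_bilinear:
  assumes "open S" "bounded_bilinear b" "smooth_on S f" "smooth_on S g"
  shows "smooth_on S (\<lambda>x. b (f x) (g x))"
  unfolding smooth_on_def
  by (intro allI higher_differentiable_on_bilinear[OF assms(1,2) smooth_onD[OF assms(3)] smooth_onD[OF assms(4)]])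

lemma smooth_on_const: "smooth_on S (\<lambda>x. c)"
  by (simp add: smooth_on_def higher_differentiable_on_const)

lemma smooth_on_id: "open S \<Longrightarrow> smooth_on S (\<lambda>x. x)"
proof (unfold smooth_on_def, intro allI)
  fix k assume S: "open S"
  show "higher_differentiable_on S (\<lambda>x. x) k"
  proof (cases k)
    case (Suc j)
    then show ?thesis
      using higher_differentiable_on_SucI[OF S has_derivative_ident higher_differentiable_on_const]
      by simp
  qed auto
qed

lemma smooth_on_add:
  assumes "open S" "smooth_on S f" "smooth_on S g"
  shows "smooth_on S (\<lambda>x. f x + g x)"
  unfolding smooth_on_def
  by (intro allI higher_differentiable_on_add[OF assms(1) smooth_onD[OF assms(2)] smooth_onD[OF assms(3)]])

lemma smooth_on_diff:
  assumes "open S" "smooth_on S f" "smooth_on S g"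
  shows "smooth_on S (\<lambda>x. f x - g x)"
  using smooth_on_add[OF assms(1,2) smooth_on_linear[OF assms(1) bounded_linear_minus[OF bounded_linear_ident] assms(3)]]
  by simp

lemma smooth_on_sum:
  assumes "open S" "\<And>i. i \<in> A \<Longrightarrow> smooth_on S (f i)"
  shows "smooth_on S (\<lambda>x. \<Sum>i\<in>A. f i x)"
  unfolding smooth_on_def
  by (intro allI higher_differentiable_on_sum[OF assms(1) smooth_onD[OF assms(2)]])

lemma smooth_on_inverse:
  fixes f :: "'a::real_normed_vector \<Rightarrow> real"
  assumes "open S" "\<And>x. x \<in> S \<Longrightarrow> f x \<noteq> 0" "smooth_on S f"
  shows "smooth_on S (\<lambda>x. inverse (f x))"
  unfolding smooth_on_def
  by (intro allI higher_differentiable_on_inverse[OF assms(1,2) smooth_onD[OF assms(3)]])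

lemma smooth_on_norm:
  fixes f :: "'a::real_normed_vector \<Rightarrow> 'b::real_inner"
  assumes "open S" "\<And>x. x \<in> S \<Longrightarrow> f x \<noteq> 0" "smooth_on S f"
  shows "smooth_on S (\<lambda>x. norm (f x))"
proof -
  have "smooth_on S (\<lambda>x. f x \<bullet> f x)"
    by (rule smooth_on_bilinear[OF assms(1) bounded_bilinear_inner assms(3,3)])
  then show ?thesis
    unfolding norm_eq_sqrt_inner smooth_on_def
    by (intro allI higher_differentiable_on_sqrt[OF assms(1)])
       (simp_all add: assms(2) smooth_onD)
qed

lemma smooth_on_Pair:
  assumes "open S" "smooth_on S f" "smooth_on S g"
  shows "smooth_on S (\<lambda>x. (f x, g x))"
proof -
  have "bounded_linear (\<lambda>a. (a, 0::'c))" "bounded_linear (\<lambda>b. (0::'b, b))"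
    by (auto intro: bounded_linear_Pair bounded_linear_ident bounded_linear_zero)
  from smooth_on_add[OF assms(1) smooth_on_linear[OF assms(1) this(1) assms(2)]
      smooth_on_linear[OF assms(1) this(2) assms(3)]]
  show ?thesis by simp
qed

lemma smooth_on_vec:
  fixes f :: "'a::real_normed_vector \<Rightarrow> 'i::finite \<Rightarrow> real"
  assumes "open S" "\<And>i. smooth_on S (\<lambda>x. f x i)"
  shows "smooth_on S (\<lambda>x. \<chi> i. f x i)"
proof -
  have eq: "(\<chi> i. f x i) = (\<Sum>i\<in>UNIV. f x i *\<^sub>R axis i 1)" for x
    by (simp add: vec_eq_iff axis_def if_distrib cong: if_cong)
  show ?thesis
    unfolding eq
    by (intro smooth_on_sum smooth_on_bilinear[OF _ bounded_bilinear_scaleR] smooth_on_const assms)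
qed

section \<open>The smooth inverse function theorem\<close>

text \<open>The map \<open>(y, c) \<mapsto> (y, b y c)\<close> inverts \<open>(y, c) \<mapsto> (y, a y c)\<close>, and the inverse of a differentiable
  map is differentiable wherever the derivative is invertible. This makes the family of inverses
  differentiable as a whole, in place of Cramer's rule.\<close>

lemma has_derivative_inverse_family:
  fixes a b :: "'a::euclidean_space \<Rightarrow> 'b::euclidean_space \<Rightarrow> 'b"
  assumes "open S" and y: "y \<in> S"
    and lin: "\<And>y. y \<in> S \<Longrightarrow> linear (a y)"
    and ab: "\<And>y c. y \<in> S \<Longrightarrow> a y (b y c) = c" and ba: "\<And>y c. y \<in> S \<Longrightarrow> b y (a y c) = c"
    and der: "\<And>y c. y \<in> S \<Longrightarrow> ((\<lambda>y. a y c) has_derivative (\<lambda>h. a' y h c)) (at y)"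
  shows "((\<lambda>y. b y w) has_derivative
      (\<lambda>h. - b y (\<Sum>e\<in>Basis. (b y w \<bullet> e) *\<^sub>R a' y h e))) (at y)"
proof -
  define F where "F = (\<lambda>q::'a \<times> 'b. (fst q, a (fst q) (snd q)))"
  define G where "G = (\<lambda>q::'a \<times> 'b. (fst q, b (fst q) (snd q)))"
  have linb: "linear (b y)" if "y \<in> S" for y
    by (rule right_inverse_linear[OF lin[OF that]]) (simp add: fun_eq_iff ab that)
  define A where "A = (\<lambda>c h. \<Sum>e\<in>Basis. (c \<bullet> e) *\<^sub>R a' y h e)"
  have expand: "a y c = (\<Sum>e\<in>Basis. (c \<bullet> e) *\<^sub>R a y e)" if "y \<in> S" for y c
    using lin[OF that] by (rule linear_euclidean_expansion)
  let ?E = "\<lambda>q::'a \<times> 'b. \<Sum>e\<in>Basis. (snd q \<bullet> e) *\<^sub>R a (fst q) e"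
  have S: "open (S \<times> (UNIV :: 'b set))" using assms(1) by (simp add: open_Times)
  have derE: "(?E has_derivative
      (\<lambda>k. \<Sum>e\<in>Basis. (snd q \<bullet> e) *\<^sub>R a' (fst q) (fst k) e + (snd k \<bullet> e) *\<^sub>R a (fst q) e)) (at q)"
    if "q \<in> S \<times> UNIV" for q
  proof (rule has_derivative_sum)
    fix e :: 'b
    have "((\<lambda>q. a (fst q) e) has_derivative (\<lambda>k. a' (fst q) (fst k) e)) (at q)"
      using has_derivative_compose[OF has_derivative_fst[OF has_derivative_ident] der] that by auto
    from has_derivative_scaleR[OF
        has_derivative_inner_left[OF has_derivative_snd[OF has_derivative_ident]] this]
    show "((\<lambda>q. (snd q \<bullet> e) *\<^sub>R a (fst q) e) has_derivative
        (\<lambda>k. (snd q \<bullet> e) *\<^sub>R a' (fst q) (fst k) e + (snd k \<bullet> e) *\<^sub>R a (fst q) e)) (at q)" .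
  qed
  have derF: "(F has_derivative (\<lambda>k. (fst k,
      \<Sum>e\<in>Basis. (snd q \<bullet> e) *\<^sub>R a' (fst q) (fst k) e + (snd k \<bullet> e) *\<^sub>R a (fst q) e))) (at q)"
    if "q \<in> S \<times> UNIV" for q
  proof -
    have "((\<lambda>q. (fst q, ?E q)) has_derivative (\<lambda>k. (fst k,
      \<Sum>e\<in>Basis. (snd q \<bullet> e) *\<^sub>R a' (fst q) (fst k) e + (snd k \<bullet> e) *\<^sub>R a (fst q) e))) (at q)"
      by (intro has_derivative_Pair derE[OF that] derivative_intros)
    then show ?thesis
      by (rule has_derivative_transform_within_open[OF _ S that])
         (auto simp: F_def expand[symmetric])
  qed
  let ?q = "(y, b y w)"
  have cont: "continuous_on (S \<times> UNIV) F"
    using derF by (meson continuous_at_imp_continuous_on has_derivative_continuous)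
  have q: "?q \<in> S \<times> UNIV" using y by simp
  have GF: "G (F q) = q" if "q \<in> S \<times> UNIV" for q
    using that by (auto simp: F_def G_def ba)
  have F: "(F has_derivative (\<lambda>k. (fst k, A (b y w) (fst k) + a y (snd k)))) (at ?q)"
    using derF[of ?q] y unfolding A_def
    by (simp add: sum.distrib expand[OF y, symmetric])
  have right: "(\<lambda>k. (fst k, A (b y w) (fst k) + a y (snd k))) \<circ>
      (\<lambda>k. (fst k, b y (snd k - A (b y w) (fst k)))) = id"
    by (auto simp: fun_eq_iff ab y)
  have "(G has_derivative (\<lambda>k. (fst k, b y (snd k - A (b y w) (fst k))))) (at (F ?q))"
    by (rule has_derivative_inverse_strong[OF S q cont GF F right])
  then have G: "(G has_derivative (\<lambda>k. (fst k, b y (snd k - A (b y w) (fst k))))) (at (y, w))"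
    by (simp add: F_def ab y)
  have "((\<lambda>y. snd (G (y, w))) has_derivative (\<lambda>h. b y (0 - A (b y w) h))) (at y)"
    using has_derivative_snd[OF has_derivative_compose[OF has_derivative_Pair[OF has_derivative_ident
          has_derivative_const] G]] by simp
  then show ?thesis
    using linear_neg[OF linb[OF y]] by (simp add: G_def A_def)
qed

lemma higher_differentiable_on_inverse_family:
  fixes a b :: "'a::euclidean_space \<Rightarrow> 'b::euclidean_space \<Rightarrow> 'b"
  assumes "open S"
    and lin: "\<And>y. y \<in> S \<Longrightarrow> linear (a y)"
    and ab: "\<And>y c. y \<in> S \<Longrightarrow> a y (b y c) = c" and ba: "\<And>y c. y \<in> S \<Longrightarrow> b y (a y c) = c"
    and der: "\<And>y c. y \<in> S \<Longrightarrow> ((\<lambda>y. a y c) has_derivative D (\<lambda>y. a y c) y) (at y)"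
    and "\<And>c. higher_differentiable_on S (\<lambda>y. a y c) k"
  shows "higher_differentiable_on S (\<lambda>y. b y w) k"
  using assms(6)
proof (induction k arbitrary: w)
  case 0
  have "continuous_on S (\<lambda>y. b y w)"
    using has_derivative_inverse_family[OF assms(1) _ lin ab ba der]
    by (meson continuous_at_imp_continuous_on has_derivative_continuous)
  then show ?case by simp
next
  case (Suc k)
  define A where "A = (\<lambda>h y. \<Sum>e\<in>Basis. (b y w \<bullet> e) *\<^sub>R D (\<lambda>y. a y e) y h)"
  have linb: "linear (b y)" if "y \<in> S" for y
    by (rule right_inverse_linear[OF lin[OF that]]) (simp add: fun_eq_iff ab that)
  have der_b: "((\<lambda>y. b y w) has_derivative (\<lambda>h. - (\<Sum>e\<in>Basis. (A h y \<bullet> e) *\<^sub>R b y e))) (at y)"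
    if "y \<in> S" for y
    unfolding linear_euclidean_expansion[OF linb[OF that], symmetric] A_def
    by (rule has_derivative_inverse_family[OF assms(1) that lin ab ba der])
  have IH: "higher_differentiable_on S (\<lambda>y. b y c) k" for c
    by (rule Suc.IH[OF higher_differentiable_on_SucD[OF Suc.prems]])
  have "higher_differentiable_on S (A h) k" for h
    unfolding A_def
    by (rule higher_differentiable_on_sum[OF assms(1)
          higher_differentiable_on_bilinear[OF assms(1) bounded_bilinear_scaleR
            higher_differentiable_on_linear[OF assms(1) bounded_linear_inner_left IH]
            higher_differentiable_on_Suc_derivative[OF Suc.prems]]])
  note A = higher_differentiable_on_linear[OF assms(1) bounded_linear_inner_left this]
  have "higher_differentiable_on S (\<lambda>y. - (\<Sum>e\<in>Basis. (A h y \<bullet> e) *\<^sub>R b y e)) k" for h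
    by (rule higher_differentiable_on_linear[OF assms(1) bounded_linear_minus[OF bounded_linear_ident]
          higher_differentiable_on_sum[OF assms(1)
            higher_differentiable_on_bilinear[OF assms(1) bounded_bilinear_scaleR A IH]]])
  from higher_differentiable_on_SucI[OF assms(1) der_b this] show ?case .
qed

text \<open>The derivative of the local inverse \<open>g\<close> at \<open>y\<close> is the inverse of \<open>D f (g y)\<close>. If \<open>g\<close> is \<open>k\<close> times
  differentiable then so is this family of inverses, and \<open>g\<close> gains one order of differentiability.\<close>

theorem smooth_inverse_function:
  fixes f :: "'a::euclidean_space \<Rightarrow> 'a"
  assumes "open U" "smooth_on U f" "x0 \<in> U" "inj (D f x0)"
  obtains U' V g where "open U'" "U' \<subseteq> U" "x0 \<in> U'" "open V" "homeomorphism U' V f g" "smooth_on V g"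
proof -
  note der = smooth_on_imp_has_derivative[OF assms(2)]
  define f' where "f' = (\<lambda>x. Blinfun (D f x))"
  have f': "blinfun_apply (f' x) = D f x" if "x \<in> U" for x
    unfolding f'_def using has_derivative_bounded_linear[OF der[OF that]]
    by (rule bounded_linear_Blinfun_apply)
  have "continuous_on U (\<lambda>x. f' x i)" for i
    using smooth_on_imp_continuous_on[OF smooth_on_frechet_derivative[OF assms(2)], of i]
    by (simp add: f' cong: continuous_on_cong)
  then have cont: "continuous_on U f'"
    by (intro continuous_on_blinfun_componentwise) simp
  obtain h where h: "linear h" "\<And>v. h (D f x0 v) = v"
    using linear_injective_isomorphism[OF has_derivative_linear[OF der[OF assms(3)]] assms(4)]
    by blast
  have "bounded_linear h" using h(1) by (simp add: linear_conv_bounded_linear)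
  then have inv: "Blinfun h o\<^sub>L f' x0 = id_blinfun"
    by (intro blinfun_eqI) (simp add: f' assms(3) bounded_linear_Blinfun_apply h)
  have der': "(f has_derivative blinfun_apply (f' x)) (at x)" if "x \<in> U" for x
    using der[OF that] f'[OF that] by simp
  obtain U' V g g' where g: "open U'" "U' \<subseteq> U" "x0 \<in> U'" "open V" "homeomorphism U' V f g"
    "\<And>y. y \<in> V \<Longrightarrow> (g has_derivative (g' y)) (at y)"
    "\<And>y. y \<in> V \<Longrightarrow> g' y = inv (blinfun_apply (f'(g y)))"
    "\<And>y. y \<in> V \<Longrightarrow> bij (blinfun_apply (f'(g y)))"
    by (rule inverse_function_theorem[OF assms(1) _ cont assms(3) inv])
       (rule der', assumption, rule that, assumption+)
  have gU: "g y \<in> U" if "y \<in> V" for y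
    using that g(2,5) by (auto simp: homeomorphism_def)
  have bij: "bij (D f (g y))" and g': "g' y = inv (D f (g y))" if "y \<in> V" for y
    using g(7,8)[OF that] gU[OF that] by (simp_all add: f')
  note smooth_df = smooth_on_frechet_derivative[OF assms(2)]
  have der_a: "((\<lambda>y. D f (g y) c) has_derivative D (\<lambda>y. D f (g y) c) y) (at y)" if "y \<in> V" for y c
    using has_derivative_compose[OF g(6)[OF that]
        smooth_on_imp_has_derivative[OF smooth_df gU[OF that]], of c]
    by (meson differentiableI frechet_derivative_works)
  have "higher_differentiable_on V g k" for k
  proof (induction k)
    case 0
    then show ?case using g(5) by (simp add: homeomorphism_def)
  next
    case (Suc k)
    have gV: "g ` V \<subseteq> U" using gU by auto
    have "higher_differentiable_on V (\<lambda>y. D f (g y) c) k" for c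
      by (rule higher_differentiable_on_compose[OF g(4) assms(1) gV Suc smooth_onD[OF smooth_df]])
    note a = this
    have "higher_differentiable_on V (\<lambda>y. inv (D f (g y)) w) k" for w
    proof (rule higher_differentiable_on_inverse_family[OF g(4) _ _ _ der_a a])
      fix y c
      assume y: "y \<in> V"
      show "linear (D f (g y))"
        by (rule has_derivative_linear[OF der[OF gU[OF y]]])
      show "D f (g y) (inv (D f (g y)) c) = c" "inv (D f (g y)) (D f (g y) c) = c"
        using bij[OF y] by (simp_all add: surj_f_inv_f inv_f_f bij_is_surj bij_is_inj)
    qed
    then have "higher_differentiable_on V (\<lambda>y. g' y w) k" for w
      by (rule higher_differentiable_on_cong[OF g(4), rotated]) (simp add: g')
    from higher_differentiable_on_SucI[OF g(4) g(6) this] show ?case .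
  qed
  then have "smooth_on V g" by (simp add: smooth_on_def)
  with g(1-5) show ?thesis by (rule that)
qed

section \<open>Lorentzian linear algebra\<close>

lemma lprod_inner: "lprod x y = - (fst x * fst y) + snd x \<bullet> snd y"
  by (simp add: lprod_def inner_vec_def)

lemma bounded_bilinear_lprod: "bounded_bilinear (lprod :: 'n::finite mink \<Rightarrow> _)"
proof
  show "\<exists>K. \<forall>x y :: 'n mink. norm (lprod x y) \<le> norm x * norm y * K"
  proof (intro exI allI)
    fix x y :: "'n mink"
    have le: "\<bar>fst z\<bar> \<le> norm z" "norm (snd z) \<le> norm z" for z :: "'n mink"
      using norm_fst_le[of "fst z" "snd z"] norm_snd_le[of "snd z" "fst z"] by simp_all
    have "\<bar>fst x * fst y\<bar> \<le> norm x * norm y"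
      unfolding abs_mult by (intro mult_mono le) auto
    moreover have "\<bar>snd x \<bullet> snd y\<bar> \<le> norm x * norm y"
      using Cauchy_Schwarz_ineq2[of "snd x" "snd y"] mult_mono[OF le(2)[of x] le(2)[of y]]
      by auto
    ultimately show "norm (lprod x y) \<le> norm x * norm y * 2"
      by (simp add: lprod_inner)
  qed
qed (simp_all add: lprod_inner algebra_simps)

interpretation lprod: bounded_bilinear lprod
  by (rule bounded_bilinear_lprod)

lemma lprod_commute: "lprod x y = lprod y x"
  by (simp add: lprod_inner inner_commute mult.commute)

lemma lprod_timelike_null_nonzero:
  fixes n l :: "'n::finite mink"
  assumes "timelike n" "lprod l l = 0" "l \<noteq> 0"
  shows "lprod n l \<noteq> 0"
proof
  assume "lprod n l = 0"
  then have "\<bar>fst n\<bar> * \<bar>fst l\<bar> = \<bar>snd n \<bullet> snd l\<bar>"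
    by (simp add: lprod_inner abs_mult[symmetric])
  also have "\<dots> \<le> norm (snd n) * norm (snd l)"
    by (rule Cauchy_Schwarz_ineq2)
  also have l: "norm (snd l) = \<bar>fst l\<bar>"
    using assms(2) by (metis lprod_self eq_iff_diff_eq_0 norm_ge_zero real_sqrt_abs real_sqrt_unique)
  finally have *: "\<bar>fst n\<bar> * \<bar>fst l\<bar> \<le> norm (snd n) * \<bar>fst l\<bar>" .
  have "fst l \<noteq> 0"
    using l assms(3) by (auto simp: prod_eq_iff)
  with * have "\<bar>fst n\<bar> \<le> norm (snd n)" by simp
  then have "(fst n)\<^sup>2 \<le> (norm (snd n))\<^sup>2"
    by (metis abs_ge_zero power2_abs power_mono)
  with assms(1) show False by (simp add: timelike_def lprod_self)
qed

lemma future_directed_iff: "future_directed x \<longleftrightarrow> timelike x \<and> fst x > 0"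
  by (simp add: future_directed_def lprod_inner)

lemma timelike_fst_nonzero: "timelike x \<Longrightarrow> fst x \<noteq> 0"
  by (auto simp: timelike_def lprod_self)

lemma null_fst_nonzero: "lprod x x = 0 \<Longrightarrow> x \<noteq> 0 \<Longrightarrow> fst x \<noteq> 0"
  by (auto simp: lprod_self prod_eq_iff)

lemma fst_ltilde [simp]: "fst (ltilde v) = 1"
  by (simp add: ltilde_def)

lemma ltilde_eq: "ltilde v = (1, (1 / fst v) *\<^sub>R snd v)"
  by (simp add: ltilde_def vec_eq_iff)

lemma scaleR_ltilde: "fst v \<noteq> 0 \<Longrightarrow> fst v *\<^sub>R ltilde v = v"
  by (simp add: ltilde_eq prod_eq_iff)

lemma ltilde_scaleR: "c \<noteq> 0 \<Longrightarrow> ltilde (c *\<^sub>R v) = ltilde v"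
  by (simp add: ltilde_eq)

lemma ltilde_ltilde [simp]: "ltilde (ltilde v) = ltilde v"
  by (simp add: ltilde_eq)

lemma ltilde_eq_scaleR: "fst v \<noteq> 0 \<Longrightarrow> ltilde v = (1 / fst v) *\<^sub>R v"
  by (simp add: ltilde_eq prod_eq_iff)

lemma lprod_ltilde_self: "lprod v v = 0 \<Longrightarrow> fst v \<noteq> 0 \<Longrightarrow> lprod (ltilde v) (ltilde v) = 0"
  by (simp add: ltilde_eq_scaleR lprod.scaleR_left lprod.scaleR_right)

text \<open>A Lorentzian space that contains the spacelike hyperplane \<open>A (\<real>\<^sup>s \<times> 0)\<close> is the orthogonal sum
  of the hyperplane and a timelike line. Counting dimensions gives a nonzero vector orthogonal to
  the hyperplane; it is timelike because the form would otherwise be nonnegative.\<close>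

lemma timelike_orthogonal_complement:
  fixes A :: "(real ^ 's::finite) \<times> real \<Rightarrow> 'n::finite mink"
  assumes A: "linear A" "inj A"
    and pos: "\<And>a. a \<noteq> 0 \<Longrightarrow> lprod (A (a, 0)) (A (a, 0)) > 0"
    and e: "timelike (A e)"
  obtains N where "N \<in> range A" "timelike N" "\<And>a. lprod N (A (a, 0)) = 0"
    "\<And>y. \<exists>a c. A y = A (a, 0) + c *\<^sub>R N"
proof -
  define f where "f = (\<lambda>y. \<chi> i. lprod (A y) (A (axis i 1, 0)))"
  have "linear f"
    by (intro linearI) (simp_all add: f_def vec_eq_iff linear_add[OF A(1)] linear_scale[OF A(1)]
        lprod.add_left lprod.scaleR_left)
  have "\<not> inj f"
  proof
    assume "inj f"
    then have "dim (range f) = DIM((real ^ 's) \<times> real)"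
      using dim_image_eq[OF \<open>linear f\<close>, of UNIV] by (simp add: dim_UNIV)
    then show False
      using dim_subset_UNIV[of "range f"] by simp
  qed
  then obtain w where w: "w \<noteq> 0" "f w = 0"
    using linear_injective_0[OF \<open>linear f\<close>] by blast
  have orth: "lprod (A w) (A (a, 0)) = 0" for a
  proof -
    have "linear (\<lambda>a. lprod (A w) (A (a, 0)))"
      by (intro linearI)
         (simp_all add: lprod.add_right[symmetric] lprod.scaleR_right[symmetric]
           linear_add[OF A(1), symmetric] linear_scale[OF A(1), symmetric] del: real_scaleR_def)
    moreover have "lprod (A w) (A (b, 0)) = 0" if "b \<in> Basis" for b
    proof -
      have "\<forall>i. lprod (A w) (A (axis i 1, 0)) = 0"
        using w(2) by (simp add: f_def vec_eq_iff)
      with that show ?thesis by (auto simp: Basis_vec_def)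
    qed
    ultimately show ?thesis
      by (subst linear_euclidean_expansion[where f = "\<lambda>a. lprod (A w) (A (a, 0))"]) auto
  qed
  have "snd w \<noteq> 0"
  proof
    assume "snd w = 0"
    then have "w = (fst w, 0)" by (simp add: prod_eq_iff)
    then show False using orth[of "fst w"] pos[of "fst w"] w(1)
      by (metis less_irrefl zero_prod_def)
  qed
  have dec: "A y = A (fst y - (snd y / snd w) *\<^sub>R fst w, 0) + (snd y / snd w) *\<^sub>R A w" for y
  proof -
    have "y = (fst y - (snd y / snd w) *\<^sub>R fst w, 0) + (snd y / snd w) *\<^sub>R w"
      using \<open>snd w \<noteq> 0\<close> by (simp add: prod_eq_iff)
    from arg_cong[where f = A, OF this] show ?thesis
      by (simp only: linear_add[OF A(1)] linear_scale[OF A(1)])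
  qed
  have "lprod (A w) (A w) < 0"
  proof (rule ccontr)
    assume "\<not> ?thesis"
    then have nonneg: "c * c * lprod (A w) (A w) \<ge> 0" for c
      by (intro mult_nonneg_nonneg zero_le_square) simp
    obtain a c where "A e = A (a, 0) + c *\<^sub>R A w"
      using dec by blast
    then have "lprod (A e) (A e) = lprod (A (a, 0)) (A (a, 0)) + c * c * lprod (A w) (A w)"
      using orth[of a] lprod_commute[of "A (a, 0)" "A w"]
      by (simp add: lprod.add_left lprod.add_right lprod.scaleR_left lprod.scaleR_right)
    moreover have "lprod (A (a, 0)) (A (a, 0)) \<ge> 0"
      using pos[of a] linear_0[OF A(1)]
      by (cases "a = 0") (auto simp: lprod.zero_left zero_prod_def[symmetric])
    ultimately show False
      using e nonneg[of c] by (simp add: timelike_def)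
  qed
  then have "timelike (A w)"
    by (auto simp: timelike_def lprod.zero_left)
  with orth dec show ?thesis
    by (intro that[of "A w"]) blast+
qed

lemma ex1_future_unit:
  fixes A :: "(real ^ 's::finite) \<times> real \<Rightarrow> 'n::finite mink"
  assumes A: "linear A" "inj A"
    and pos: "\<And>a. a \<noteq> 0 \<Longrightarrow> lprod (A (a, 0)) (A (a, 0)) > 0"
    and e: "timelike (A e)"
  shows "\<exists>!n. future_directed n \<and> lprod n n = -1 \<and> n \<in> range A \<and> (\<forall>a. lprod n (A (a, 0)) = 0)"
    and "\<lbrakk>future_directed n; lprod n n = -1; n \<in> range A; \<forall>a. lprod n (A (a, 0)) = 0\<rbrakk> \<Longrightarrow>
      \<exists>a c. A y = A (a, 0) + c *\<^sub>R n"
proof -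
  obtain N where N: "N \<in> range A" "timelike N" "\<And>a. lprod N (A (a, 0)) = 0"
    "\<And>y. \<exists>a c. A y = A (a, 0) + c *\<^sub>R N"
    using timelike_orthogonal_complement[OF assms] by blast
  have zero: "A (a, 0) = 0" if "lprod (A (a, 0)) (A (a, 0)) = 0" for a
    using that pos[of a] linear_0[OF A(1)] by (cases "a = 0") (auto simp: zero_prod_def)
  have mult: "\<exists>c. n = c *\<^sub>R N" if n: "n \<in> range A" "\<forall>a. lprod n (A (a, 0)) = 0" for n
  proof -
    obtain a c where ac: "n = A (a, 0) + c *\<^sub>R N"
      using n(1) N(4) by blast
    have "lprod (A (a, 0)) (A (a, 0)) = 0"
      using n(2)[rule_format, of a] N(3)[of a]
      by (simp add: ac lprod.add_left lprod.scaleR_left)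
    from zero[OF this] ac show ?thesis by auto
  qed
  define q where "q = sqrt (- lprod N N)"
  have q: "q > 0" "q * q = - lprod N N"
    using N(2) by (auto simp: q_def timelike_def)
  define n where "n = (sgn (fst N) / q) *\<^sub>R N"
  have "lprod n n = (sgn (fst N) * sgn (fst N)) * (lprod N N / (q * q))"
    by (simp add: n_def lprod.scaleR_left lprod.scaleR_right)
  also have "\<dots> = -1"
    using q N(2) timelike_fst_nonzero[OF N(2)] by (simp add: sgn_mult_self_eq timelike_def)
  finally have nn: "lprod n n = -1" .
  have "fst n > 0"
    using q timelike_fst_nonzero[OF N(2)] by (simp add: n_def sgn_if)
  with nn have fut: "future_directed n"
    by (auto simp: future_directed_iff timelike_def)
  have nA: "n \<in> range A"
    using N(1) linear_scale[OF A(1)] by (metis n_def rangeE rangeI)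
  have n_orth: "lprod n (A (a, 0)) = 0" for a
    using N(3) by (simp add: n_def lprod.scaleR_left)
  define r where "r = q * sgn (fst N)"
  have Nn: "N = r *\<^sub>R n"
    using q timelike_fst_nonzero[OF N(2)] by (simp add: r_def n_def sgn_mult_self_eq)
  have uniq: "n' = n" if n': "future_directed n'" "lprod n' n' = -1" "n' \<in> range A"
    "\<forall>a. lprod n' (A (a, 0)) = 0" for n'
  proof -
    obtain c' where "n' = c' *\<^sub>R N" using mult[OF n'(3,4)] by blast
    also have "\<dots> = (c' * r) *\<^sub>R n" by (subst Nn) simp
    finally obtain c where c: "n' = c *\<^sub>R n" by blast
    with nn n'(2) have "c * c = 1" by (simp add: lprod.scaleR_left lprod.scaleR_right)
    moreover have "c > 0"
      using n'(1) fut by (simp add: c future_directed_iff zero_less_mult_iff)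
    ultimately have "c = 1" by (simp add: square_eq_1_iff)
    with c show ?thesis by simp
  qed
  show "\<exists>!n. future_directed n \<and> lprod n n = -1 \<and> n \<in> range A \<and> (\<forall>a. lprod n (A (a, 0)) = 0)"
  proof (rule ex1I[of _ n])
    show "future_directed n \<and> lprod n n = -1 \<and> n \<in> range A \<and> (\<forall>a. lprod n (A (a, 0)) = 0)"
      using fut nn nA n_orth by blast
  qed (elim conjE, rule uniq)
  show "\<exists>a c. A y = A (a, 0) + c *\<^sub>R n'"
    if "future_directed n'" "lprod n' n' = -1" "n' \<in> range A" "\<forall>a. lprod n' (A (a, 0)) = 0" for n'
  proof -
    obtain a c where "A y = A (a, 0) + c *\<^sub>R N" using N(4) by blast
    also have "c *\<^sub>R N = (c * r) *\<^sub>R n'"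
      unfolding uniq[OF that] by (subst Nn) simp
    finally show ?thesis by blast
  qed
qed

section \<open>World sheets and the lightcone pedal map\<close>

lemma LC_ltilde:
  assumes "v \<in> LC"
  shows "lprod (ltilde v) (ltilde v) = 0" "fst v \<noteq> 0" "v = fst v *\<^sub>R ltilde v"
  using assms by (auto simp: LC_def lprod_ltilde_self scaleR_ltilde)

context
  fixes X :: "(real ^ 's::finite) \<times> real \<Rightarrow> 'n::finite mink"
    and U :: "(real ^ 's) set" and I :: "real set"
  assumes ws: "world_sheet X U I"
begin

lemma open_domain: "open (U \<times> I)"
  using ws by (simp add: world_sheet_def open_Times)

lemma smooth_X: "smooth_on (U \<times> I) X"
  using ws by (simp add: world_sheet_def smooth_embedding_on_def)

lemma der_X: "z \<in> U \<times> I \<Longrightarrow> (X has_derivative D X z) (at z)"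
  by (rule smooth_on_imp_has_derivative[OF smooth_X])

lemma linear_DX: "z \<in> U \<times> I \<Longrightarrow> linear (D X z)"
  by (rule has_derivative_linear[OF der_X])

lemma inj_DX: "z \<in> U \<times> I \<Longrightarrow> inj (D X z)"
  using ws by (auto simp: world_sheet_def smooth_embedding_on_def)

lemma der_X_slice:
  assumes "z \<in> U \<times> I"
  shows "((\<lambda>u. X (u, snd z)) has_derivative (\<lambda>a. D X z (a, 0))) (at (fst z))"
  using has_derivative_compose[OF has_derivative_Pair[OF has_derivative_ident has_derivative_const],
      of X "D X z" "fst z" "snd z" UNIV] der_X[OF assms] by simp

lemma tangent_S_eq:
  assumes "z \<in> U \<times> I"
  shows "tangent_S X z = range (\<lambda>a. D X z (a, 0))"
  unfolding tangent_S_def frechet_derivative_at[OF der_X_slice[OF assms], symmetric] ..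

lemma slice_spacelike:
  assumes "z \<in> U \<times> I" "a \<noteq> 0"
  shows "lprod (D X z (a, 0)) (D X z (a, 0)) > 0"
proof -
  have "(a, 0) \<noteq> (0 :: (real ^ 's) \<times> real)"
    using assms(2) by (simp add: zero_prod_def)
  then have "D X z (a, 0) \<noteq> 0"
    using linear_injective_0[OF linear_DX[OF assms(1)]] inj_DX[OF assms(1)] by blast
  moreover have "D X z (a, 0) \<in> tangent_S X z"
    by (simp add: tangent_S_eq[OF assms(1)])
  ultimately show ?thesis
    using ws assms(1) unfolding world_sheet_def spacelike_def by blast
qed

lemma slice_orthogonal_iff:
  assumes "z \<in> U \<times> I"
  shows "(\<forall>a. lprod (D X z (a, 0)) l = 0) \<longleftrightarrow> (\<forall>i. lprod (D X z (axis i 1, 0)) l = 0)"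
proof
  assume *: "\<forall>i. lprod (D X z (axis i 1, 0)) l = 0"
  have "linear (\<lambda>a. lprod (D X z (a, 0)) l)"
    by (intro linearI)
       (simp_all add: lprod.add_left[symmetric] lprod.scaleR_left[symmetric]
         linear_add[OF linear_DX[OF assms], symmetric] linear_scale[OF linear_DX[OF assms], symmetric]
         del: real_scaleR_def)
  moreover have "lprod (D X z (b, 0)) l = 0" if "b \<in> Basis" for b
    using that * by (auto simp: Basis_vec_def)
  ultimately show "\<forall>a. lprod (D X z (a, 0)) l = 0"
    by (subst linear_euclidean_expansion[where f = "\<lambda>a. lprod (D X z (a, 0)) l"]) auto
qed simp

lemma nT:
  assumes "z \<in> U \<times> I"
  shows "future_directed (nT X z)" "lprod (nT X z) (nT X z) = -1" "nT X z \<in> range (D X z)"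
    "\<And>a. lprod (nT X z) (D X z (a, 0)) = 0"
    "\<And>y. \<exists>a c. D X z y = D X z (a, 0) + c *\<^sub>R nT X z"
proof -
  obtain e where e: "timelike (D X z e)"
    using ws assms unfolding world_sheet_def lorentzian_subspace_def tangent_W_def by blast
  note unit = ex1_future_unit[OF linear_DX[OF assms] inj_DX[OF assms] slice_spacelike[OF assms] e]
  have eq: "nT X z = (THE n. future_directed n \<and> lprod n n = -1 \<and> n \<in> range (D X z) \<and>
      (\<forall>a. lprod n (D X z (a, 0)) = 0))"
    by (simp add: nT_def tangent_W_def tangent_S_eq[OF assms])
  from theI'[OF unit(1)]
  show *: "future_directed (nT X z)" "lprod (nT X z) (nT X z) = -1" "nT X z \<in> range (D X z)"
    "\<And>a. lprod (nT X z) (D X z (a, 0)) = 0"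
    unfolding eq by blast+
  show "\<exists>a c. D X z y = D X z (a, 0) + c *\<^sub>R nT X z" for y
    using unit(2)[OF _ *(1-3)] *(4) by blast
qed

lemma height_du_eq:
  assumes "z \<in> U \<times> I"
  shows "height_du X i z v = lprod (D X z (axis i 1, 0)) (ltilde v)"
proof -
  have "((\<lambda>u. height X (u, snd z) v) has_derivative (\<lambda>a. lprod (D X z (a, 0)) (ltilde v))) (at (fst z))"
    unfolding height_def
    using has_derivative_diff[OF bounded_linear.has_derivative[OF
          lprod.bounded_linear_left der_X_slice[OF assms]] has_derivative_const] by simp
  from frechet_derivative_at[OF this] show ?thesis
    by (simp add: height_du_def fun_eq_iff)
qed

lemma mem_Sigma_star_iff:
  "(u, v, t) \<in> Sigma_star X U I \<longleftrightarrow> (u, t) \<in> U \<times> I \<and> v \<in> LC \<and>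
    lprod (X (u, t)) (ltilde v) = fst v \<and> (\<forall>a. lprod (D X (u, t) (a, 0)) (ltilde v) = 0)"
proof (cases "(u, t) \<in> U \<times> I")
  case True
  then show ?thesis
    using slice_orthogonal_iff[OF True, of "ltilde v"]
    by (auto simp: Sigma_star_def height_du_eq height_def)
qed (auto simp: Sigma_star_def)

text \<open>The vectors \<open>nT + \<xi>\<close> run through one representative of every null line orthogonal to the slice:
  a nonzero null \<open>l\<close> is never orthogonal to the timelike \<open>nT\<close>, so it can be rescaled to
  \<open>lprod nT l = -1\<close>, and then \<open>\<xi> = l - nT\<close> is a unit normal of the world sheet.\<close>

lemma null_normal_imp_N1:
  assumes z: "z \<in> U \<times> I" and l: "lprod l l = 0" "l \<noteq> 0" "\<And>a. lprod (D X z (a, 0)) l = 0"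
  obtains \<xi> where "(z, \<xi>) \<in> N1 X U I" "LG X (z, \<xi>) = ltilde l"
proof -
  define c where "c = - lprod (nT X z) l"
  have "c \<noteq> 0"
    using lprod_timelike_null_nonzero[OF _ l(1,2)] nT(1)[OF z]
    by (simp add: c_def future_directed_iff)
  define \<xi> where "\<xi> = (1 / c) *\<^sub>R l - nT X z"
  have ln: "lprod l (nT X z) = - c" by (simp add: c_def lprod_commute)
  have unit: "lprod \<xi> \<xi> = 1"
    using \<open>c \<noteq> 0\<close> l(1) nT(2)[OF z] ln lprod_commute[of "nT X z" l]
    by (simp add: \<xi>_def lprod.diff_left lprod.diff_right lprod.scaleR_left lprod.scaleR_right)
  have \<xi>n: "lprod \<xi> (nT X z) = 0"
    using \<open>c \<noteq> 0\<close> nT(2)[OF z] ln by (simp add: \<xi>_def lprod.diff_left lprod.scaleR_left)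
  have \<xi>s: "lprod \<xi> (D X z (a, 0)) = 0" for a
    using l(3)[of a] nT(4)[OF z, of a]
    by (simp add: \<xi>_def lprod.diff_left lprod.scaleR_left lprod_commute[of l])
  have "lprod \<xi> (D X z y) = 0" for y
  proof -
    obtain a d where "D X z y = D X z (a, 0) + d *\<^sub>R nT X z"
      using nT(5)[OF z] by blast
    then show ?thesis by (simp add: lprod.add_right lprod.scaleR_right \<xi>n \<xi>s)
  qed
  then have "(z, \<xi>) \<in> N1 X U I"
    using z unit by (auto simp: N1_def normal_W_def tangent_W_def)
  moreover have "LG X (z, \<xi>) = ltilde l"
    using \<open>c \<noteq> 0\<close> by (simp add: LG_def \<xi>_def ltilde_scaleR)
  ultimately show ?thesis by (rule that)
qed

lemma N1_imp_null_normal: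
  assumes "(z, \<xi>) \<in> N1 X U I"
  shows "z \<in> U \<times> I" "lprod (LG X (z, \<xi>)) (LG X (z, \<xi>)) = 0"
    "\<And>a. lprod (D X z (a, 0)) (LG X (z, \<xi>)) = 0"
proof -
  define l where "l = nT X z + \<xi>"
  show z: "z \<in> U \<times> I"
    using assms by (simp add: N1_def)
  have \<xi>: "lprod \<xi> (D X z y) = 0" "lprod \<xi> \<xi> = 1" for y
    using assms by (cases y, auto simp: N1_def normal_W_def tangent_W_def)
  have n\<xi>: "lprod \<xi> (nT X z) = 0"
    using nT(3)[OF z] \<xi>(1) by auto
  have null: "lprod l l = 0"
    using n\<xi> \<xi>(2) nT(2)[OF z] lprod_commute[of "nT X z" \<xi>]
    by (simp add: l_def lprod.add_left lprod.add_right)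
  have "lprod \<xi> l = 1"
    using n\<xi> \<xi>(2) by (simp add: l_def lprod.add_right)
  then have "l \<noteq> 0" by (auto simp: lprod.zero_right)
  then have l0: "fst l \<noteq> 0" by (rule null_fst_nonzero[OF null])
  show "lprod (LG X (z, \<xi>)) (LG X (z, \<xi>)) = 0"
    using lprod_ltilde_self[OF null l0] by (simp add: LG_def l_def)
  show "lprod (D X z (a, 0)) (LG X (z, \<xi>)) = 0" for a
  proof -
    have "lprod (D X z (a, 0)) l = 0"
      using \<xi>(1) nT(4)[OF z, of a] by (simp add: l_def lprod.add_right lprod_commute[of "D X z (a, 0)"])
    then show ?thesis
      using l0 by (simp add: LG_def l_def[symmetric] ltilde_eq_scaleR lprod.scaleR_right)
  qed
qed

lemma momentary_pedal_LC_iff: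
  assumes "q \<in> N1 X U I"
  shows "momentary_pedal X q \<in> LC \<longleftrightarrow> pedal_coeff X q \<noteq> 0"
proof -
  obtain z \<xi> where q: "q = (z, \<xi>)" by (cases q)
  show ?thesis
    using N1_imp_null_normal(2)[OF assms[unfolded q]]
    by (auto simp: momentary_pedal_def LC_def q lprod.scaleR_left lprod.scaleR_right LG_def)
qed

theorem front_eq_pedal_image:
  "pt_proj ` legendrian_lift X ` Sigma_star X U I = unfolded_pedal X ` N1 X U I \<inter> (LC \<times> I)"
proof (intro equalityI subsetI)
  fix m
  assume "m \<in> pt_proj ` legendrian_lift X ` Sigma_star X U I"
  then obtain u v t where m: "m = (v, t)" and "(u, v, t) \<in> Sigma_star X U I"
    by (auto simp: pt_proj_def legendrian_lift_def)
  then have z: "(u, t) \<in> U \<times> I" and v: "v \<in> LC" and X: "lprod (X (u, t)) (ltilde v) = fst v"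
    and S: "\<And>a. lprod (D X (u, t) (a, 0)) (ltilde v) = 0"
    by (auto simp: mem_Sigma_star_iff)
  have "ltilde v \<noteq> 0"
    by (metis fst_ltilde fst_zero zero_neq_one)
  then obtain \<xi> where \<xi>: "((u, t), \<xi>) \<in> N1 X U I" "LG X ((u, t), \<xi>) = ltilde v"
    using null_normal_imp_N1[OF z LC_ltilde(1)[OF v] _ S] by (metis ltilde_ltilde)
  then have "unfolded_pedal X ((u, t), \<xi>) = (v, t)"
    using X LC_ltilde(3)[OF v] by (simp add: unfolded_pedal_def momentary_pedal_def pedal_coeff_def)
  then show "m \<in> unfolded_pedal X ` N1 X U I \<inter> (LC \<times> I)"
    using \<xi>(1) v z m by (metis IntI SigmaD2 SigmaI image_eqI)
next
  fix m
  assume m: "m \<in> unfolded_pedal X ` N1 X U I \<inter> (LC \<times> I)"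
  then obtain u t \<xi> where q: "((u, t), \<xi>) \<in> N1 X U I" "m = unfolded_pedal X ((u, t), \<xi>)"
    by auto
  define v where "v = momentary_pedal X ((u, t), \<xi>)"
  have mv: "m = (v, t)" by (simp add: q(2) unfolded_pedal_def v_def)
  have v: "v \<in> LC" using m mv by auto
  have "ltilde v = LG X ((u, t), \<xi>)"
    using v unfolding v_def momentary_pedal_LC_iff[OF q(1)]
    by (simp add: momentary_pedal_def ltilde_scaleR LG_def)
  then have "(u, v, t) \<in> Sigma_star X U I"
    using v N1_imp_null_normal[OF q(1)]
    by (auto simp: mem_Sigma_star_iff v_def momentary_pedal_def pedal_coeff_def LG_def)
  then show "m \<in> pt_proj ` legendrian_lift X ` Sigma_star X U I"
    by (force simp: mv pt_proj_def legendrian_lift_def image_iff)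
qed

end

section \<open>The topology of the projective cotangent bundle\<close>

lemma openin_pt_topology:
  fixes S :: "'n::finite pt_point set"
  shows "openin (pt_topology I) S \<longleftrightarrow> S \<subseteq> PT I \<and>
     openin (top_of_set ((LC \<times> I) \<times> (UNIV - {0})))
       {(m, \<alpha>). m \<in> LC \<times> I \<and> \<alpha> \<noteq> 0 \<and> (m, proj_class \<alpha>) \<in> S}"
proof -
  let ?q = "\<lambda>S :: 'n pt_point set. {(m, \<alpha>). m \<in> LC \<times> I \<and> \<alpha> \<noteq> 0 \<and> (m, proj_class \<alpha>) \<in> S}"
  define L where "L = (\<lambda>S. S \<subseteq> PT I \<and> openin (top_of_set ((LC \<times> I) \<times> (UNIV - {0}))) (?q S))"
  have "L (S \<inter> T)" if "L S" "L T" for S T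
  proof -
    have "?q (S \<inter> T) = ?q S \<inter> ?q T" by auto
    with that show ?thesis by (auto simp: L_def)
  qed
  moreover have "L (\<Union>K)" if "\<forall>S\<in>K. L S" for K
  proof -
    have "?q (\<Union>K) = \<Union>(?q ` K)" by auto
    moreover have "openin (top_of_set ((LC \<times> I) \<times> (UNIV - {0}))) (\<Union>(?q ` K))"
      using that by (intro openin_Union) (auto simp: L_def)
    ultimately show ?thesis
      using that by (auto simp: L_def)
  qed
  ultimately have "istopology L"
    by (simp add: istopology_def)
  then show ?thesis
    using topology_inverse'[of L] by (simp add: pt_topology_def L_def)
qed

lemma PT_I: "m \<in> LC \<times> I \<Longrightarrow> \<alpha> \<noteq> 0 \<Longrightarrow> (m, proj_class \<alpha>) \<in> PT I"
  unfolding PT_def by blast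

lemma topspace_pt_topology: "topspace (pt_topology I) = PT I"
proof
  show "topspace (pt_topology I) \<subseteq> PT I"
    using openin_topspace[of "pt_topology I"] unfolding openin_pt_topology by blast
  have eq: "{(m, \<alpha>). m \<in> LC \<times> I \<and> \<alpha> \<noteq> 0 \<and> (m, proj_class \<alpha>) \<in> PT I} = (LC \<times> I) \<times> (UNIV - {0})"
    using PT_I by blast
  have "openin (pt_topology I) (PT I)"
    unfolding openin_pt_topology eq by simp
  then show "PT I \<subseteq> topspace (pt_topology I)"
    by (rule openin_subset)
qed

lemma proj_class_eqD:
  assumes "proj_class \<alpha> = proj_class \<beta>" "\<beta> \<noteq> 0"
  obtains c where "c \<noteq> 0" "\<beta> = c *\<^sub>R \<alpha>"
proof -
  have "\<beta> \<in> span {\<alpha>}"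
    using assms(1) span_base[of \<beta> "{\<beta>}"] by (simp add: proj_class_def)
  then obtain c where "\<beta> = c *\<^sub>R \<alpha>"
    by (auto simp: span_singleton)
  with assms(2) that show ?thesis by force
qed

definition radial_value :: "('n::finite mink \<times> real) \<times> 'n covec \<Rightarrow> real" where
  "radial_value q = fst (snd q) \<bullet> snd (fst (fst q))"

text \<open>On the covectors of nonzero radial value: the representative of a class \<open>[\<beta>]\<close> over \<open>(v, t)\<close> that takes the value \<open>- v\<^sub>0\<close> on the radial
  tangent vector \<open>v\<close> of the cone.\<close>

definition radial_normalization :: "('n::finite mink \<times> real) \<times> 'n covec \<Rightarrow> ('n mink \<times> real) \<times> 'n covec" where
  "radial_normalization q = (fst q, (- fst (fst (fst q)) / radial_value q) *\<^sub>R snd q)"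

lemma radial_value_scaleR: "radial_value (m, c *\<^sub>R \<beta>) = c * radial_value (m, \<beta>)"
  by (simp add: radial_value_def)

lemma radial_normalization_scaleR:
  "c \<noteq> 0 \<Longrightarrow> radial_normalization (m, c *\<^sub>R \<beta>) = radial_normalization (m, \<beta>)"
  by (simp add: radial_normalization_def radial_value_scaleR)

lemma continuous_on_radial_value: "continuous_on S radial_value"
  unfolding radial_value_def by (intro continuous_intros)

lemma openin_pt_topology_radial:
  fixes h :: "('n::finite mink \<times> real) \<times> 'n covec \<Rightarrow> 'b::topological_space"
  assumes h: "continuous_on UNIV h" and T: "open T"
  shows "openin (pt_topology I) {(m, proj_class \<beta>) | m \<beta>. m \<in> LC \<times> I \<and> \<beta> \<noteq> 0 \<and>
    radial_value (m, \<beta>) \<noteq> 0 \<and> h (radial_normalization (m, \<beta>)) \<in> T}" (is "openin _ ?O")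
proof -
  let ?M = "((LC \<times> I) \<times> (UNIV - {0})) :: (('n mink \<times> real) \<times> 'n covec) set"
  let ?M' = "?M \<inter> radial_value -` (UNIV - {0})"
  have eq: "{(m, \<alpha>). m \<in> LC \<times> I \<and> \<alpha> \<noteq> 0 \<and> (m, proj_class \<alpha>) \<in> ?O} =
      ?M' \<inter> (\<lambda>q. h (radial_normalization q)) -` T"
  proof (intro set_eqI iffI)
    fix q
    assume "q \<in> {(m, \<alpha>). m \<in> LC \<times> I \<and> \<alpha> \<noteq> 0 \<and> (m, proj_class \<alpha>) \<in> ?O}"
    then obtain m \<alpha> \<beta> where q: "q = (m, \<alpha>)" "m \<in> LC \<times> I" "\<alpha> \<noteq> 0" "proj_class \<alpha> = proj_class \<beta>" "\<beta> \<noteq> 0"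
      "radial_value (m, \<beta>) \<noteq> 0" "h (radial_normalization (m, \<beta>)) \<in> T"
      by blast
    obtain c where "c \<noteq> 0" "\<beta> = c *\<^sub>R \<alpha>"
      by (rule proj_class_eqD[OF q(4,5)])
    with q show "q \<in> ?M' \<inter> (\<lambda>q. h (radial_normalization q)) -` T"
      by (simp add: radial_value_scaleR radial_normalization_scaleR)
  qed blast
  have o1: "openin (top_of_set ?M) ?M'"
    by (intro continuous_openin_preimage_gen continuous_on_radial_value) auto
  have o2: "openin (top_of_set ?M') (?M' \<inter> (\<lambda>q. h (radial_normalization q)) -` T)"
  proof (intro continuous_openin_preimage_gen T continuous_on_compose2[OF h])
    show "continuous_on ?M' radial_normalization"
      unfolding radial_normalization_def
      by (intro continuous_intros continuous_on_radial_value) auto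
  qed auto
  have sub: "?O \<subseteq> PT I"
    by (blast intro: PT_I)
  show ?thesis
    unfolding openin_pt_topology eq by (intro conjI sub openin_trans[OF o2 o1])
qed

lemma continuous_map_projectivization:
  fixes m :: "'b::topological_space \<Rightarrow> 'n::finite mink \<times> real" and \<alpha> :: "'b \<Rightarrow> 'n covec"
  assumes "continuous_on B m" "continuous_on B \<alpha>" "\<And>y. y \<in> B \<Longrightarrow> m y \<in> LC \<times> I \<and> \<alpha> y \<noteq> 0"
  shows "continuous_map (top_of_set B) (pt_topology I) (\<lambda>y. (m y, proj_class (\<alpha> y)))"
  unfolding continuous_map_def
proof (intro conjI allI impI)
  show "(\<lambda>y. (m y, proj_class (\<alpha> y))) \<in> topspace (top_of_set B) \<rightarrow> topspace (pt_topology I)"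
    using assms(3) unfolding topspace_pt_topology by (intro funcsetI PT_I) simp_all
next
  fix S :: "'n pt_point set"
  assume "openin (pt_topology I) S"
  then have S: "openin (top_of_set ((LC \<times> I) \<times> (UNIV - {0})))
       {(m, \<alpha>). m \<in> LC \<times> I \<and> \<alpha> \<noteq> 0 \<and> (m, proj_class \<alpha>) \<in> S}" (is "openin _ ?S")
    by (simp add: openin_pt_topology)
  have "(\<lambda>y. (m y, \<alpha> y)) \<in> B \<rightarrow> (LC \<times> I) \<times> (UNIV - {0})"
    using assms(3) by (intro funcsetI) simp
  from continuous_openin_preimage[OF continuous_on_Pair[OF assms(1,2)] this S]
  have "openin (top_of_set B) (B \<inter> (\<lambda>y. (m y, \<alpha> y)) -` ?S)" .
  also have "B \<inter> (\<lambda>y. (m y, \<alpha> y)) -` ?S = {y \<in> topspace (top_of_set B). (m y, proj_class (\<alpha> y)) \<in> S}"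
    using assms(3) by auto
  finally show "openin (top_of_set B) {y \<in> topspace (top_of_set B). (m y, proj_class (\<alpha> y)) \<in> S}" .
qed

text \<open>Covectors normalized on the radial direction are determined by their classes, continuously.
  Hence the projectivization of an embedding by normalized covectors is still an embedding.\<close>

lemma embedding_map_projectivization:
  fixes m :: "'b::topological_space \<Rightarrow> 'n::finite mink \<times> real" and \<alpha> :: "'b \<Rightarrow> 'n covec"
    and h :: "('n mink \<times> real) \<times> 'n covec \<Rightarrow> 'c::topological_space"
  assumes cont: "continuous_on B m" "continuous_on B \<alpha>"
    and LC: "\<And>y. y \<in> B \<Longrightarrow> m y \<in> LC \<times> I"
    and rad: "\<And>y. y \<in> B \<Longrightarrow> radial_value (m y, \<alpha> y) = - fst (fst (m y))"
    and h: "continuous_on UNIV h"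
    and inj: "inj_on (\<lambda>y. h (m y, \<alpha> y)) B"
    and op: "\<And>S. openin (top_of_set B) S \<Longrightarrow> open ((\<lambda>y. h (m y, \<alpha> y)) ` S)"
  shows "embedding_map (top_of_set B) (pt_topology I) (\<lambda>y. (m y, proj_class (\<alpha> y)))"
proof -
  let ?\<phi> = "\<lambda>y. (m y, proj_class (\<alpha> y))"
  have rad0: "radial_value (m y, \<alpha> y) \<noteq> 0" if "y \<in> B" for y
    using LC[OF that] rad[OF that] by (auto simp: LC_def)
  have \<alpha>0: "\<alpha> y \<noteq> 0" if "y \<in> B" for y
    using rad0[OF that] by (auto simp: radial_value_def)
  have normal: "radial_normalization (m y, \<alpha> y) = (m y, \<alpha> y)" if "y \<in> B" for y
    using rad[OF that] rad0[OF that] by (simp add: radial_normalization_def)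
  have lift: "h (radial_normalization (m y, \<beta>)) = h (m y, \<alpha> y)"
    if y: "y \<in> B" and \<beta>: "\<beta> \<noteq> 0" "proj_class (\<alpha> y) = proj_class \<beta>" for y \<beta>
  proof -
    obtain c where "c \<noteq> 0" "\<beta> = c *\<^sub>R \<alpha> y"
      by (rule proj_class_eqD[OF \<beta>(2,1)])
    then show ?thesis
      using normal[OF y] by (simp add: radial_normalization_scaleR)
  qed
  have "inj_on ?\<phi> B"
  proof (rule inj_onI)
    fix y z
    assume y: "y \<in> B" and z: "z \<in> B" and "?\<phi> y = ?\<phi> z"
    then have eq: "m y = m z" "proj_class (\<alpha> y) = proj_class (\<alpha> z)" by auto
    have "h (m y, \<alpha> y) = h (m z, \<alpha> z)"
      using lift[OF y \<alpha>0[OF z] eq(2)] normal[OF z] eq(1) by simp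
    with inj y z show "y = z" by (meson inj_onD)
  qed
  moreover have cm: "continuous_map (top_of_set B) (pt_topology I) ?\<phi>"
    using LC \<alpha>0 by (intro continuous_map_projectivization cont) auto
  moreover have "open_map (top_of_set B) (subtopology (pt_topology I) (?\<phi> ` B)) ?\<phi>"
    unfolding open_map_def
  proof (intro allI impI)
    fix S
    assume S: "openin (top_of_set B) S"
    then have SB: "S \<subseteq> B" using openin_imp_subset by blast
    let ?T = "(\<lambda>y. h (m y, \<alpha> y)) ` S"
    let ?O = "{(m, proj_class \<beta>) | m \<beta>. m \<in> LC \<times> I \<and> \<beta> \<noteq> 0 \<and>
      radial_value (m, \<beta>) \<noteq> 0 \<and> h (radial_normalization (m, \<beta>)) \<in> ?T}"
    have "openin (pt_topology I) ?O"
      by (rule openin_pt_topology_radial[OF h op[OF S]])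
    moreover have "?\<phi> ` S = ?O \<inter> ?\<phi> ` B"
    proof (intro equalityI subsetI)
      fix l
      assume "l \<in> ?\<phi> ` S"
      then obtain y where y: "y \<in> S" "l = ?\<phi> y" by blast
      then have yB: "y \<in> B" using SB by blast
      have T: "h (radial_normalization (m y, \<alpha> y)) \<in> ?T"
        unfolding normal[OF yB] using y(1) by blast
      have "l \<in> ?O"
        unfolding y(2) mem_Collect_eq
        by (intro exI[of _ "m y"] exI[of _ "\<alpha> y"] conjI refl LC[OF yB] \<alpha>0[OF yB] rad0[OF yB] T)
      then show "l \<in> ?O \<inter> ?\<phi> ` B"
        using yB y(2) by blast
    next
      fix l
      assume "l \<in> ?O \<inter> ?\<phi> ` B"
      then obtain y \<beta> x where y: "y \<in> B" "l = ?\<phi> y" "proj_class (\<alpha> y) = proj_class \<beta>" "\<beta> \<noteq> 0"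
        and x: "x \<in> S" "h (radial_normalization (m y, \<beta>)) = h (m x, \<alpha> x)"
        by auto
      have "h (m y, \<alpha> y) = h (m x, \<alpha> x)"
        using lift[OF y(1) y(4) y(3)] x(2) by simp
      then have "y = x"
        using inj y(1) x(1) SB by (meson inj_onD subsetD)
      then show "l \<in> ?\<phi> ` S" using x(1) y(2) by blast
    qed
    ultimately show "openin (subtopology (pt_topology I) (?\<phi> ` B)) (?\<phi> ` S)"
      unfolding openin_subtopology by blast
  qed
  ultimately show ?thesis
    unfolding embedding_map_def
    by (intro bijective_open_imp_homeomorphic_map)
       (use cm continuous_map_image_subset_topspace[OF cm] in
         \<open>auto simp: continuous_map_in_subtopology\<close>)
qed

section \<open>Linear surjections\<close>

lemma linear_surjI:
  fixes L :: "'a::real_vector \<Rightarrow> 'b::euclidean_space"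
  assumes "linear L" "\<And>c. (\<And>h. L h \<bullet> c = 0) \<Longrightarrow> c = 0"
  shows "surj L"
proof (rule ccontr)
  assume *: "\<not> surj L"
  have sub: "subspace (range L)"
    by (rule linear_subspace_image[OF assms(1) subspace_UNIV])
  have "dim (range L) < DIM('b)"
  proof (rule ccontr)
    assume "\<not> ?thesis"
    then have "dim (range L) = DIM('b)"
      using dim_subset_UNIV[of "range L"] by simp
    then have "span (range L) = UNIV" by (simp add: dim_eq_full)
    with sub have "range L = UNIV" by (simp add: span_eq_iff[THEN iffD2])
    with * show False by simp
  qed
  then obtain c where "c \<noteq> 0" "\<And>y. y \<in> span (range L) \<Longrightarrow> orthogonal c y"
    using orthogonal_to_subspace_exists by blast
  then have "L h \<bullet> c = 0" for h
    using span_base[of "L h" "range L"] inner_commute[of "L h" c] by (simp add: orthogonal_def)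
  with assms(2) \<open>c \<noteq> 0\<close> show False by blast
qed

text \<open>The kernel of \<open>L\<close> is the orthogonal complement of the range of the adjoint, hence of the right
  dimension for the missing coordinates \<open>P\<close>.\<close>

lemma linear_surj_completion:
  fixes L :: "'a::euclidean_space \<Rightarrow> 'b::euclidean_space"
  assumes "linear L" "surj L" "DIM('a) = DIM('b) + DIM('c)"
  obtains P :: "'a \<Rightarrow> 'c::euclidean_space" where "linear P" "inj (\<lambda>x. (L x, P x))"
proof -
  note adj = adjoint_works[OF assms(1)] and lin = adjoint_linear[OF assms(1)]
  have "inj (adjoint L)"
    unfolding linear_injective_0[OF lin]
  proof (intro allI impI)
    fix y
    assume 0: "adjoint L y = 0"
    obtain x where "L x = y" using assms(2) by (metis surjD)
    then have "y \<bullet> y = x \<bullet> adjoint L y" using adj[of x y] by simp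
    with 0 show "y = 0" by simp
  qed
  then have "dim (range (adjoint L)) = DIM('b)"
    using dim_image_eq[OF lin, of UNIV] by (simp add: dim_UNIV)
  moreover define K where "K = {x. \<forall>y\<in>range (adjoint L). orthogonal y x}"
  have "dim K + dim (range (adjoint L)) = DIM('a)"
    using dim_subspace_orthogonal_to_vectors[of "range (adjoint L)" UNIV] linear_subspace_image[OF lin subspace_UNIV]
    by (simp add: K_def dim_UNIV)
  ultimately have "dim K = dim (UNIV :: 'c set)"
    using assms(3) by (simp add: dim_UNIV)
  moreover have "subspace K"
    unfolding K_def by (rule subspace_orthogonal_to_vectors)
  ultimately obtain P :: "'a \<Rightarrow> 'c" where P: "linear P" "inj_on P K"
    using subspace_isomorphism[of K "UNIV :: 'c set"] subspace_UNIV by metis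
  have "x = 0" if "L x = 0" "P x = 0" for x
  proof -
    have "x \<in> K"
      using that(1) adj by (auto simp: K_def orthogonal_def inner_commute)
    moreover have "0 \<in> K" using \<open>subspace K\<close> by (rule subspace_0)
    ultimately show ?thesis
      using inj_onD[OF P(2), of x 0] that(2) linear_0[OF P(1)] by simp
  qed
  moreover have "linear (\<lambda>x. (L x, P x))"
    using assms(1) P(1) by (intro linearI) (simp_all add: linear_add linear_scale)
  ultimately have "inj (\<lambda>x. (L x, P x))"
    by (simp add: linear_injective_0 zero_prod_def)
  with P(1) that show ?thesis by blast
qed

section \<open>The extended height function in the chart of the cone\<close>

text \<open>The direction \<open>\<omega>\<close> with \<open>ltilde v = (1, \<omega>)\<close> for \<open>v = lc_chart_inv \<epsilon> x\<close>.\<close>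

definition lc_dir :: "real \<Rightarrow> real ^ 'n::finite \<Rightarrow> real ^ 'n" where
  "lc_dir \<epsilon> x = (\<epsilon> / norm x) *\<^sub>R x"

context
  fixes \<epsilon> :: real
  assumes eps: "\<epsilon> = 1 \<or> \<epsilon> = -1"
begin

lemma lc_dir_self: "x \<noteq> 0 \<Longrightarrow> lc_dir \<epsilon> x \<bullet> lc_dir \<epsilon> x = 1"
  using eps by (auto simp: lc_dir_def power2_norm_eq_inner[symmetric] power2_eq_square)

lemma lc_dir_inner: "lc_dir \<epsilon> x \<bullet> x = \<epsilon> * norm x"
  by (simp add: lc_dir_def power2_norm_eq_inner[symmetric] power2_eq_square)

lemma lc_dir_scale: "(\<epsilon> * norm x) *\<^sub>R lc_dir \<epsilon> x = x"
  using eps by (auto simp: lc_dir_def)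

lemma ltilde_chart: "ltilde (lc_chart_inv \<epsilon> x) = (1, lc_dir \<epsilon> x)"
  using eps by (auto simp: ltilde_eq lc_chart_inv_def lc_dir_def)

lemma lc_chart_inv_LC: "x \<noteq> 0 \<Longrightarrow> lc_chart_inv \<epsilon> x \<in> LC"
  using eps by (auto simp: LC_eq_graphs)

lemma has_derivative_radius:
  "x \<noteq> 0 \<Longrightarrow> ((\<lambda>x. \<epsilon> * norm x) has_derivative (\<lambda>h. lc_dir \<epsilon> x \<bullet> h)) (at x)"
  using has_derivative_mult_right[OF has_derivative_norm, of x \<epsilon>]
  by (simp add: lc_dir_def sgn_div_norm inner_commute divide_inverse mult.assoc)

lemma has_derivative_lc_dir:
  fixes x :: "real ^ 'n::finite"
  assumes "x \<noteq> 0"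
  shows "(lc_dir \<epsilon> has_derivative
    (\<lambda>h. (1 / (\<epsilon> * norm x)) *\<^sub>R (h - (lc_dir \<epsilon> x \<bullet> h) *\<^sub>R lc_dir \<epsilon> x))) (at x)"
proof -
  have nz: "\<epsilon> * norm x \<noteq> 0" using assms eps by auto
  have eq: "lc_dir \<epsilon> = (\<lambda>x. inverse (\<epsilon> * norm x) *\<^sub>R (x :: real ^ 'n))"
    using eps by (auto simp: lc_dir_def fun_eq_iff divide_inverse)
  have "((\<lambda>x. inverse (\<epsilon> * norm x) *\<^sub>R x) has_derivative (\<lambda>h. inverse (\<epsilon> * norm x) *\<^sub>R h +
      (- (inverse (\<epsilon> * norm x) * (lc_dir \<epsilon> x \<bullet> h) * inverse (\<epsilon> * norm x))) *\<^sub>R x)) (at x)"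
    by (rule has_derivative_scaleR[OF Deriv.has_derivative_inverse[OF nz has_derivative_radius[OF assms]]
          has_derivative_ident])
  moreover have "inverse (\<epsilon> * norm x) *\<^sub>R h +
      (- (inverse (\<epsilon> * norm x) * (lc_dir \<epsilon> x \<bullet> h) * inverse (\<epsilon> * norm x))) *\<^sub>R x =
      (1 / (\<epsilon> * norm x)) *\<^sub>R (h - (lc_dir \<epsilon> x \<bullet> h) *\<^sub>R lc_dir \<epsilon> x)" for h
  proof -
    have "inverse (\<epsilon> * norm x) *\<^sub>R x = lc_dir \<epsilon> x"
      by (simp only: eq)
    then have "(- (inverse (\<epsilon> * norm x) * (lc_dir \<epsilon> x \<bullet> h) * inverse (\<epsilon> * norm x))) *\<^sub>R x =
        (- (inverse (\<epsilon> * norm x) * (lc_dir \<epsilon> x \<bullet> h))) *\<^sub>R lc_dir \<epsilon> x"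
      by (metis minus_mult_left scaleR_scaleR)
    then show ?thesis
      by (simp add: scaleR_diff_right divide_inverse)
  qed
  ultimately show ?thesis
    unfolding eq[symmetric] by simp
qed

end

type_synonym ('s, 'n) chart_point = "((real ^ 's) \<times> real) \<times> (real ^ 'n)"

abbreviation chart_domain :: "(real ^ 's::finite) set \<Rightarrow> real set \<Rightarrow>
    ('s, 'n::finite) chart_point set" where
  "chart_domain U I \<equiv> (U \<times> I) \<times> (UNIV - {0})"

definition height_chart :: "((real ^ 's::finite) \<times> real \<Rightarrow> 'n::finite mink) \<Rightarrow> real \<Rightarrow>
    ('s, 'n) chart_point \<Rightarrow> real" where
  "height_chart X \<epsilon> p = lprod (X (fst p)) (1, lc_dir \<epsilon> (snd p)) - \<epsilon> * norm (snd p)"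

text \<open>The \<open>x\<close>-gradient of \<open>height_chart\<close>: the differential of \<open>\<omega>\<close> at \<open>x\<close> is the projection along \<open>\<omega>\<close>
  divided by \<open>v\<^sub>0 = \<epsilon> * norm x\<close>, and the differential of \<open>v\<^sub>0\<close> is the inner product with \<open>\<omega>\<close>.\<close>

definition height_grad :: "((real ^ 's::finite) \<times> real \<Rightarrow> 'n::finite mink) \<Rightarrow> real \<Rightarrow>
    ('s, 'n) chart_point \<Rightarrow> real ^ 'n" where
  "height_grad X \<epsilon> p = (1 / (\<epsilon> * norm (snd p))) *\<^sub>R
     (snd (X (fst p)) - (snd (X (fst p)) \<bullet> lc_dir \<epsilon> (snd p)) *\<^sub>R lc_dir \<epsilon> (snd p)) - lc_dir \<epsilon> (snd p)"

definition height_covec :: "((real ^ 's::finite) \<times> real \<Rightarrow> 'n::finite mink) \<Rightarrow> real \<Rightarrow>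
    ('s, 'n) chart_point \<Rightarrow> 'n covec" where
  "height_covec X \<epsilon> p = (height_grad X \<epsilon> p, lprod (D X (fst p) (0, 1)) (1, lc_dir \<epsilon> (snd p)))"

text \<open>Its zero set is \<^const>\<open>Sigma_star\<close> in the chart.\<close>

definition height_constraint :: "((real ^ 's::finite) \<times> real \<Rightarrow> 'n::finite mink) \<Rightarrow> real \<Rightarrow>
    ('s, 'n) chart_point \<Rightarrow> (real ^ 's) \<times> real" where
  "height_constraint X \<epsilon> p =
     ((\<chi> i. lprod (D X (fst p) (axis i 1, 0)) (1, lc_dir \<epsilon> (snd p))), height_chart X \<epsilon> p)"

definition unchart :: "real \<Rightarrow> ('s::finite, 'n::finite) chart_point \<Rightarrow>
    (real ^ 's) \<times> 'n mink \<times> real" where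
  "unchart \<epsilon> p = (fst (fst p), lc_chart_inv \<epsilon> (snd p), snd (fst p))"

context
  fixes X :: "(real ^ 's::finite) \<times> real \<Rightarrow> 'n::finite mink"
    and U :: "(real ^ 's) set" and I :: "real set" and \<epsilon> :: real
  assumes ws: "world_sheet X U I" and eps: "\<epsilon> = 1 \<or> \<epsilon> = -1"
begin

lemma open_chart_domain: "open (chart_domain U I :: ('s, 'n) chart_point set)"
  by (intro open_Times open_domain[OF ws] open_Diff) auto

lemma smooth_X_fst: "smooth_on (chart_domain U I) (\<lambda>p :: ('s, 'n) chart_point. X (fst p))"
  by (rule smooth_on_compose[OF open_chart_domain open_domain[OF ws] _
        smooth_on_linear[OF open_chart_domain bounded_linear_fst smooth_on_id[OF open_chart_domain]] smooth_X[OF ws]]) auto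

lemma smooth_DX_fst: "smooth_on (chart_domain U I) (\<lambda>p :: ('s, 'n) chart_point. D X (fst p) w)"
  by (rule smooth_on_compose[OF open_chart_domain open_domain[OF ws] _
        smooth_on_linear[OF open_chart_domain bounded_linear_fst smooth_on_id[OF open_chart_domain]]
        smooth_on_frechet_derivative[OF smooth_X[OF ws]]]) auto

lemma smooth_radius: "smooth_on (chart_domain U I) (\<lambda>p :: ('s, 'n) chart_point. \<epsilon> * norm (snd p))"
proof (rule smooth_on_bilinear[OF open_chart_domain bounded_bilinear_mult smooth_on_const])
  show "smooth_on (chart_domain U I) (\<lambda>p :: ('s, 'n) chart_point. norm (snd p))"
    by (rule smooth_on_norm[OF open_chart_domain _
          smooth_on_linear[OF open_chart_domain bounded_linear_snd smooth_on_id[OF open_chart_domain]]]) auto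
qed

lemma smooth_inverse_radius: "smooth_on (chart_domain U I) (\<lambda>p :: ('s, 'n) chart_point. 1 / (\<epsilon> * norm (snd p)))"
  unfolding inverse_eq_divide[symmetric]
  by (rule smooth_on_inverse[OF open_chart_domain _ smooth_radius]) (use eps in auto)

lemma smooth_lc_dir: "smooth_on (chart_domain U I) (\<lambda>p :: ('s, 'n) chart_point. lc_dir \<epsilon> (snd p))"
proof -
  have eq: "lc_dir \<epsilon> x = (1 / (\<epsilon> * norm x)) *\<^sub>R x" for x :: "real ^ 'n"
    using eps by (auto simp: lc_dir_def)
  show ?thesis
    unfolding eq
    by (rule smooth_on_bilinear[OF open_chart_domain bounded_bilinear_scaleR smooth_inverse_radius
          smooth_on_linear[OF open_chart_domain bounded_linear_snd smooth_on_id[OF open_chart_domain]]])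
qed

lemma smooth_null_dir: "smooth_on (chart_domain U I) (\<lambda>p :: ('s, 'n) chart_point. (1 :: real, lc_dir \<epsilon> (snd p)))"
  by (rule smooth_on_Pair[OF open_chart_domain smooth_on_const smooth_lc_dir])

lemma smooth_height_grad: "smooth_on (chart_domain U I) (height_grad X \<epsilon>)"
proof -
  have X': "smooth_on (chart_domain U I) (\<lambda>p :: ('s, 'n) chart_point. snd (X (fst p)))"
    by (rule smooth_on_linear[OF open_chart_domain bounded_linear_snd smooth_X_fst])
  show ?thesis
    unfolding height_grad_def
    by (rule smooth_on_diff[OF open_chart_domain smooth_on_bilinear[OF open_chart_domain bounded_bilinear_scaleR
            smooth_inverse_radius smooth_on_diff[OF open_chart_domain X'
              smooth_on_bilinear[OF open_chart_domain bounded_bilinear_scaleR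
                smooth_on_bilinear[OF open_chart_domain bounded_bilinear_inner X' smooth_lc_dir] smooth_lc_dir]]]
          smooth_lc_dir])
qed

lemma smooth_height_covec: "smooth_on (chart_domain U I) (height_covec X \<epsilon>)"
  unfolding height_covec_def
  by (rule smooth_on_Pair[OF open_chart_domain smooth_height_grad
        smooth_on_bilinear[OF open_chart_domain bounded_bilinear_lprod smooth_DX_fst smooth_null_dir]])

lemma smooth_height_constraint: "smooth_on (chart_domain U I) (height_constraint X \<epsilon>)"
  unfolding height_constraint_def height_chart_def
  by (rule smooth_on_Pair[OF open_chart_domain smooth_on_vec[OF open_chart_domain
          smooth_on_bilinear[OF open_chart_domain bounded_bilinear_lprod smooth_DX_fst smooth_null_dir]]
        smooth_on_diff[OF open_chart_domain
          smooth_on_bilinear[OF open_chart_domain bounded_bilinear_lprod smooth_X_fst smooth_null_dir]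
          smooth_radius]])

lemma smooth_lc_chart_inv: "smooth_on (chart_domain U I) (\<lambda>p :: ('s, 'n) chart_point. lc_chart_inv \<epsilon> (snd p))"
  unfolding lc_chart_inv_def
  by (rule smooth_on_Pair[OF open_chart_domain smooth_radius
        smooth_on_linear[OF open_chart_domain bounded_linear_snd smooth_on_id[OF open_chart_domain]]])

lemma der_null_dir:
  fixes p :: "('s, 'n) chart_point"
  assumes "p \<in> chart_domain U I"
  shows "((\<lambda>p. (1 :: real, lc_dir \<epsilon> (snd p))) has_derivative (\<lambda>w. (0, (1 / (\<epsilon> * norm (snd p))) *\<^sub>R
    (snd w - (lc_dir \<epsilon> (snd p) \<bullet> snd w) *\<^sub>R lc_dir \<epsilon> (snd p))))) (at p)"
  using assms
  by (intro has_derivative_Pair has_derivative_const has_derivative_compose[OF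
        has_derivative_snd[OF has_derivative_ident] has_derivative_lc_dir[OF eps]]) auto

lemma der_height_chart:
  assumes p: "p \<in> chart_domain U I"
  shows "(height_chart X \<epsilon> has_derivative (\<lambda>w. lprod (D X (fst p) (fst w)) (1, lc_dir \<epsilon> (snd p)) +
    height_grad X \<epsilon> p \<bullet> snd w)) (at p)"
proof -
  have "((\<lambda>p. X (fst p)) has_derivative (\<lambda>w. D X (fst p) (fst w))) (at p)"
    using p by (intro has_derivative_compose[OF has_derivative_fst[OF has_derivative_ident] der_X[OF ws]]) auto
  moreover have "((\<lambda>p. \<epsilon> * norm (snd p)) has_derivative (\<lambda>w. lc_dir \<epsilon> (snd p) \<bullet> snd w)) (at p)"
    using p by (intro has_derivative_compose[OF has_derivative_snd[OF has_derivative_ident]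
          has_derivative_radius[OF eps]]) auto
  ultimately show ?thesis
    unfolding height_chart_def
    by (rule has_derivative_eq_rhs[OF has_derivative_diff[OF lprod.FDERIV[OF _ der_null_dir[OF p]]]])
       (simp add: fun_eq_iff height_grad_def lprod_inner algebra_simps inner_commute
          inner_left_distrib inner_right_distrib diff_divide_distrib)
qed

lemma height_chart_eq: "height X z (lc_chart_inv \<epsilon> x) = height_chart X \<epsilon> (z, x)"
  by (simp add: height_def height_chart_def ltilde_chart[OF eps]) (simp add: lc_chart_inv_def)

lemma legendrian_lift_unchart:
  assumes p: "p \<in> chart_domain U I"
  shows "legendrian_lift X (unchart \<epsilon> p) =
    ((lc_chart_inv \<epsilon> (snd p), snd (fst p)), proj_class (height_covec X \<epsilon> p))"
proof -
  obtain u t x where p_eq: "p = ((u, t), x)" by (metis prod.collapse)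
  then have z: "(u, t) \<in> U \<times> I" and x: "x \<noteq> 0" using p by auto
  have sgn: "sgn (fst (lc_chart_inv \<epsilon> x)) = \<epsilon>"
    using eps x by (auto simp: lc_chart_inv_def sgn_mult)
  have "((\<lambda>x. height X (u, t) (lc_chart_inv \<epsilon> x)) has_derivative
      (\<lambda>h. lprod (D X (u, t) 0) (1, lc_dir \<epsilon> x) + height_grad X \<epsilon> p \<bullet> h)) (at x)"
    unfolding height_chart_eq
    using has_derivative_compose[OF has_derivative_Pair[OF has_derivative_const has_derivative_ident]
        der_height_chart[OF p, unfolded p_eq]] by (simp add: p_eq)
  note e = frechet_derivative_at[OF this, symmetric]
  have "snd (lc_chart_inv \<epsilon> x) = x" by (simp add: lc_chart_inv_def)
  then have dx: "height_dx X i (u, t) (lc_chart_inv \<epsilon> x) = height_grad X \<epsilon> p $ i" for i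
    unfolding height_dx_def sgn
    by (simp add: e linear_0[OF linear_DX[OF ws z]] lprod.zero_left inner_axis)
  have "((\<lambda>s. X (u, s)) has_derivative (\<lambda>s. D X (u, t) (0, s))) (at t)"
    using has_derivative_compose[OF has_derivative_Pair[OF has_derivative_const has_derivative_ident],
        of X _ u t UNIV] der_X[OF ws z] by simp
  then have dt: "((\<lambda>s. height X (u, s) (lc_chart_inv \<epsilon> x)) has_derivative
      (\<lambda>s. lprod (D X (u, t) (0, s)) (1, lc_dir \<epsilon> x))) (at t)"
    unfolding height_def ltilde_chart[OF eps]
    by (rule has_derivative_eq_rhs[OF has_derivative_diff[OF
          bounded_linear.has_derivative[OF lprod.bounded_linear_left] has_derivative_const]]) simp
  have scale: "lprod (D X (u, t) (0, s)) l = lprod (D X (u, t) (0, 1)) l * s" for s l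
    using linear_scale[OF linear_DX[OF ws z], of s "(0, 1)"] by (simp add: lprod.scaleR_left)
  have "((\<lambda>s. height X (u, s) (lc_chart_inv \<epsilon> x)) has_field_derivative
      lprod (D X (u, t) (0, 1)) (1, lc_dir \<epsilon> x)) (at t)"
    unfolding has_field_derivative_def
    by (rule has_derivative_eq_rhs[OF dt]) (rule ext, rule scale)
  then have "height_dt X (u, t) (lc_chart_inv \<epsilon> x) = lprod (D X (u, t) (0, 1)) (1, lc_dir \<epsilon> x)"
    unfolding height_dt_def by (simp add: DERIV_imp_deriv)
  with dx show ?thesis
    by (simp add: legendrian_lift_def unchart_def height_covec_def p_eq vec_eq_iff)
qed

text \<open>The direction \<open>\<omega>\<close> is constant along rays of the cone, so of the height only \<open>- v\<^sub>0\<close> varies there.\<close>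

lemma radial_value_height_covec:
  "radial_value ((lc_chart_inv \<epsilon> (snd p), t), height_covec X \<epsilon> p) = - \<epsilon> * norm (snd p)"
proof -
  define \<omega> where "\<omega> = lc_dir \<epsilon> (snd p)"
  define r where "r = \<epsilon> * norm (snd p)"
  have x: "snd p = r *\<^sub>R \<omega>" and \<omega>x: "\<omega> \<bullet> snd p = r"
    using lc_dir_scale[OF eps, of "snd p"] lc_dir_inner[OF eps, of "snd p"] by (simp_all add: \<omega>_def r_def)
  have "snd (X (fst p)) \<bullet> snd p = (snd (X (fst p)) \<bullet> \<omega>) * r"
    by (subst x) simp
  then show ?thesis
    using \<omega>x by (simp add: radial_value_def lc_chart_inv_def height_covec_def height_grad_def
        inner_diff_left \<omega>_def[symmetric] r_def[symmetric])
qed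

lemma unchart_mem_Sigma_star_iff:
  assumes "snd p \<noteq> 0"
  shows "unchart \<epsilon> p \<in> Sigma_star X U I \<longleftrightarrow> p \<in> chart_domain U I \<and> height_constraint X \<epsilon> p = 0"
proof -
  obtain u t x where p_eq: "p = ((u, t), x)" by (metis prod.collapse)
  have x: "x \<noteq> 0" using assms p_eq by simp
  show ?thesis
  proof (cases "(u, t) \<in> U \<times> I")
    case True
    show ?thesis
      using True x lc_chart_inv_LC[OF eps x] slice_orthogonal_iff[OF ws True, of "(1, lc_dir \<epsilon> x)"]
      by (simp add: p_eq unchart_def mem_Sigma_star_iff[OF ws] ltilde_chart[OF eps] height_constraint_def
          height_chart_def zero_prod_def vec_eq_iff) (auto simp: lc_chart_inv_def)
  next
    case False
    then show ?thesis
      by (auto simp: p_eq unchart_def mem_Sigma_star_iff[OF ws])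
  qed
qed

text \<open>Orthogonality to \<open>(1, \<omega>)\<close> makes \<open>snd Y \<bullet> \<omega>\<close> the time component of \<open>Y = D X z (a, 0)\<close>, so the last
  hypothesis says that \<open>Y\<close> is null, and slices have no nonzero null tangent vectors.\<close>

lemma slice_projection_zero:
  assumes "z \<in> U \<times> I" "lprod (D X z (a, 0)) (1, \<omega>) = 0"
    and "snd (D X z (a, 0)) \<bullet> snd (D X z (a, 0)) = (snd (D X z (a, 0)) \<bullet> \<omega>) * (snd (D X z (a, 0)) \<bullet> \<omega>)"
  shows "a = 0"
proof (rule ccontr)
  assume "a \<noteq> 0"
  from slice_spacelike[OF ws assms(1) this] assms(2,3) show False
    by (simp add: lprod_inner)
qed

lemma slice_constraint:
  assumes "p \<in> chart_domain U I" "height_constraint X \<epsilon> p = 0"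
  shows "lprod (D X (fst p) (a, 0)) (1, lc_dir \<epsilon> (snd p)) = 0"
  using assms slice_orthogonal_iff[OF ws, of "fst p" "(1, lc_dir \<epsilon> (snd p))"]
  by (auto simp: height_constraint_def zero_prod_def vec_eq_iff)

end

section \<open>The Legendrian lift is a Legendrian immersion\<close>

lemma has_derivative_cong_open:
  assumes "open B" "y \<in> B" "\<And>x. x \<in> B \<Longrightarrow> f x = g x"
    "(f has_derivative f') (at y)" "(g has_derivative g') (at y)"
  shows "f' = g'"
  by (rule has_derivative_unique[OF has_derivative_transform_within_open[OF assms(4,1,2,3)] assms(5)])

context
  fixes X :: "(real ^ 's::finite) \<times> real \<Rightarrow> 'n::finite mink"
    and U :: "(real ^ 's) set" and I :: "real set" and \<epsilon> :: real
  assumes ws: "world_sheet X U I" and eps: "\<epsilon> = 1 \<or> \<epsilon> = -1"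
begin

lemma der_height_constraint_fst:
  assumes p: "p \<in> chart_domain U I"
  shows "fst (D (height_constraint X \<epsilon>) p (0, h)) $ i =
    snd (D X (fst p) (axis i 1, 0)) \<bullet> ((1 / (\<epsilon> * norm (snd p))) *\<^sub>R
      (h - (lc_dir \<epsilon> (snd p) \<bullet> h) *\<^sub>R lc_dir \<epsilon> (snd p)))"
proof -
  let ?v = "axis i 1 :: real ^ 's" and ?\<omega> = "lc_dir \<epsilon> (snd p)"
  have f: "fst (height_constraint X \<epsilon> q) $ i = lprod (D X (fst q) (?v, 0)) (1, lc_dir \<epsilon> (snd q))" for q
    by (simp add: height_constraint_def)
  have "((\<lambda>p. fst (height_constraint X \<epsilon> p) $ i) has_derivative
      (\<lambda>w. fst (D (height_constraint X \<epsilon>) p w) $ i)) (at p)"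
    by (rule bounded_linear.has_derivative[OF bounded_linear_vec_nth has_derivative_fst[OF
            smooth_on_imp_has_derivative[OF smooth_height_constraint[OF ws eps] p]]])
  note f' = this[unfolded f]
  have "((\<lambda>p. lprod (D X (fst p) (?v, 0)) (1, lc_dir \<epsilon> (snd p))) has_derivative
      (\<lambda>w. lprod (D X (fst p) (?v, 0)) (0, (1 / (\<epsilon> * norm (snd p))) *\<^sub>R (snd w - (?\<omega> \<bullet> snd w) *\<^sub>R ?\<omega>)) +
        lprod (D (\<lambda>p. D X (fst p) (?v, 0)) p w) (1, ?\<omega>))) (at p)"
    by (rule lprod.FDERIV[OF smooth_on_imp_has_derivative[OF smooth_DX_fst[OF ws eps] p]
          der_null_dir[OF ws eps p]])
  from fun_cong[OF has_derivative_unique[OF f' this], of "(0, h)"]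
  have eq: "fst (D (height_constraint X \<epsilon>) p (0, h)) $ i =
      lprod (D X (fst p) (?v, 0)) (0, (1 / (\<epsilon> * norm (snd p))) *\<^sub>R (h - (?\<omega> \<bullet> h) *\<^sub>R ?\<omega>)) +
        lprod (D (\<lambda>p. D X (fst p) (?v, 0)) p (0, h)) (1, ?\<omega>)"
    by simp
  have "((\<lambda>h. D X (fst (fst p, h)) (?v, 0)) has_derivative
      (\<lambda>h. D (\<lambda>p. D X (fst p) (?v, 0)) p (0, h))) (at (snd p))"
    by (rule has_derivative_compose[OF has_derivative_Pair[OF has_derivative_const has_derivative_ident]])
       (use smooth_on_imp_has_derivative[OF smooth_DX_fst[OF ws eps] p] in simp)
  then have "((\<lambda>h. D X (fst p) (?v, 0)) has_derivative
      (\<lambda>h. D (\<lambda>p. D X (fst p) (?v, 0)) p (0, h))) (at (snd p))"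
    by simp
  from fun_cong[OF has_derivative_unique[OF this has_derivative_const], of h]
  have "D (\<lambda>p. D X (fst p) (?v, 0)) p (0, h) = 0" .
  with eq show ?thesis
    by (simp add: lprod_inner)
qed

lemma der_height_constraint_snd:
  assumes p: "p \<in> chart_domain U I"
  shows "snd (D (height_constraint X \<epsilon>) p w) =
    lprod (D X (fst p) (fst w)) (1, lc_dir \<epsilon> (snd p)) + height_grad X \<epsilon> p \<bullet> snd w"
proof -
  have "((\<lambda>p. snd (height_constraint X \<epsilon> p)) has_derivative
      (\<lambda>w. snd (D (height_constraint X \<epsilon>) p w))) (at p)"
    by (rule has_derivative_snd[OF smooth_on_imp_has_derivative[OF smooth_height_constraint[OF ws eps] p]])
  then have "(height_chart X \<epsilon> has_derivative (\<lambda>w. snd (D (height_constraint X \<epsilon>) p w))) (at p)"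
    by (simp add: height_constraint_def)
  from has_derivative_unique[OF this der_height_chart[OF ws eps p]] show ?thesis
    by (rule fun_cong)
qed

lemma height_grad_dir:
  assumes "snd p \<noteq> 0"
  shows "height_grad X \<epsilon> p \<bullet> lc_dir \<epsilon> (snd p) = -1"
  using lc_dir_self[OF eps assms] by (simp add: height_grad_def inner_diff_left)

text \<open>Suppose that \<open>c\<close> annihilates the range. The radial direction \<open>h = \<omega>\<close> changes the height but none
  of its \<open>u\<close>-derivatives, which gives \<open>snd c = 0\<close>. What remains says that the slice tangent
  \<open>Y = D X (fst c, 0)\<close> has spatial part parallel to \<open>\<omega>\<close>; being orthogonal to \<open>(1, \<omega>)\<close>, it is null.\<close>

lemma surj_der_height_constraint:
  assumes p: "p \<in> chart_domain U I" and 0: "height_constraint X \<epsilon> p = 0"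
  shows "surj (D (height_constraint X \<epsilon>) p)"
proof (rule linear_surjI)
  let ?L = "D (height_constraint X \<epsilon>) p"
  show "linear ?L"
    by (rule has_derivative_linear[OF smooth_on_imp_has_derivative[OF smooth_height_constraint[OF ws eps] p]])
  fix c :: "(real ^ 's) \<times> real"
  assume c: "\<And>w. ?L w \<bullet> c = 0"
  define \<omega> where "\<omega> = lc_dir \<epsilon> (snd p)"
  define r where "r = \<epsilon> * norm (snd p)"
  define Y where "Y = D X (fst p) (fst c, 0)"
  have z: "fst p \<in> U \<times> I" and x: "snd p \<noteq> 0" using p by auto
  have r: "r \<noteq> 0" using x eps by (auto simp: r_def)
  have \<omega>: "\<omega> \<bullet> \<omega> = 1" using lc_dir_self[OF eps x] by (simp add: \<omega>_def)
  have Y_sum: "Y = (\<Sum>i\<in>UNIV. fst c $ i *\<^sub>R D X (fst p) (axis i 1, 0))"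
  proof -
    have lin: "linear (\<lambda>a. D X (fst p) (a, 0))"
      by (rule has_derivative_linear[OF der_X_slice[OF ws z]])
    have "fst c = (\<Sum>i\<in>UNIV. fst c $ i *\<^sub>R axis i 1)"
      by (simp add: vec_eq_iff axis_def if_distrib cong: if_cong)
    then have "Y = D X (fst p) ((\<Sum>i\<in>UNIV. fst c $ i *\<^sub>R axis i 1), 0)"
      unfolding Y_def by simp
    also have "\<dots> = (\<Sum>i\<in>UNIV. fst c $ i *\<^sub>R D X (fst p) (axis i 1, 0))"
      by (simp only: linear_sum[OF lin] linear_scale[OF lin])
    finally show ?thesis .
  qed
  have key: "snd Y \<bullet> ((1 / r) *\<^sub>R (h - (\<omega> \<bullet> h) *\<^sub>R \<omega>)) + (height_grad X \<epsilon> p \<bullet> h) * snd c = 0" for h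
  proof -
    have "snd (?L (0, h)) = height_grad X \<epsilon> p \<bullet> h"
      by (simp add: der_height_constraint_snd[OF p] linear_0[OF linear_DX[OF ws z]] lprod.zero_left)
    moreover have "fst (?L (0, h)) \<bullet> fst c = snd Y \<bullet> ((1 / r) *\<^sub>R (h - (\<omega> \<bullet> h) *\<^sub>R \<omega>))"
      unfolding inner_vec_def[of "fst (?L (0, h))"] der_height_constraint_fst[OF p] Y_sum snd_sum inner_sum_left
        \<omega>_def[symmetric] r_def[symmetric]
      by (simp add: mult.commute)
    ultimately show ?thesis
      using c[of "(0, h)"] by (simp add: inner_prod_def)
  qed
  have "snd c = 0"
    using key[of \<omega>] height_grad_dir[OF x] \<omega> by (simp add: \<omega>_def)
  then have "snd Y \<bullet> (snd Y - (\<omega> \<bullet> snd Y) *\<^sub>R \<omega>) = 0"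
    using key[of "snd Y"] r by simp
  then have "snd Y \<bullet> snd Y = (snd Y \<bullet> \<omega>) * (snd Y \<bullet> \<omega>)"
    by (simp add: inner_diff_right inner_commute)
  moreover have "lprod Y (1, \<omega>) = 0"
    unfolding Y_def \<omega>_def by (rule slice_constraint[OF ws eps p 0])
  ultimately have "fst c = 0"
    unfolding Y_def by (intro slice_projection_zero[OF ws eps z])
  with \<open>snd c = 0\<close> show "c = 0" by (simp add: prod_eq_iff)
qed

lemma der_height_grad_slice:
  assumes p: "p \<in> chart_domain U I"
  shows "D (height_grad X \<epsilon>) p (dz, 0) = (1 / (\<epsilon> * norm (snd p))) *\<^sub>R
    (snd (D X (fst p) dz) - (snd (D X (fst p) dz) \<bullet> lc_dir \<epsilon> (snd p)) *\<^sub>R lc_dir \<epsilon> (snd p))"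
proof -
  have z: "fst p \<in> U \<times> I" using p by auto
  note X' = has_derivative_snd[OF der_X[OF ws z]]
  have "((\<lambda>z. height_grad X \<epsilon> (z, snd p)) has_derivative (\<lambda>dz. D (height_grad X \<epsilon>) p (dz, 0))) (at (fst p))"
    by (rule has_derivative_compose[OF has_derivative_Pair[OF has_derivative_ident has_derivative_const]])
       (use smooth_on_imp_has_derivative[OF smooth_height_grad[OF ws eps] p] in simp)
  moreover have "((\<lambda>z. height_grad X \<epsilon> (z, snd p)) has_derivative (\<lambda>dz. (1 / (\<epsilon> * norm (snd p))) *\<^sub>R
    (snd (D X (fst p) dz) - (snd (D X (fst p) dz) \<bullet> lc_dir \<epsilon> (snd p)) *\<^sub>R lc_dir \<epsilon> (snd p)))) (at (fst p))"
    unfolding height_grad_def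
    unfolding fst_conv snd_conv
    by (rule has_derivative_eq_rhs[OF has_derivative_diff[OF has_derivative_scaleR_right[OF has_derivative_diff[OF
            X' has_derivative_scaleR_left[OF has_derivative_inner_left[OF X']]]] has_derivative_const]]) simp
  ultimately show ?thesis
    by (rule fun_cong[OF has_derivative_unique])
qed

text \<open>A patch of the lift: \<open>\<sigma>\<close> parametrizes the zero set of the constraints, on which the height function
  and its \<open>u\<close>-derivatives vanish identically. Differentiating \<open>height = 0\<close> along the patch leaves
  \<open>dx\<close>- and \<open>dt\<close>-terms only, which is the contact condition.\<close>

context
  fixes B :: "(real ^ 'n) set" and \<sigma> :: "real ^ 'n \<Rightarrow> ('s, 'n) chart_point"
    and P :: "('s, 'n) chart_point \<Rightarrow> real ^ 'n"
  assumes B: "open B" and \<sigma>: "smooth_on B \<sigma>" and P: "bounded_linear P"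
    and \<sigma>_domain: "\<And>y. y \<in> B \<Longrightarrow> \<sigma> y \<in> chart_domain U I"
    and \<sigma>_constraint: "\<And>y. y \<in> B \<Longrightarrow> height_constraint X \<epsilon> (\<sigma> y) = 0"
    and P\<sigma>: "\<And>y. y \<in> B \<Longrightarrow> P (\<sigma> y) = y"
begin

definition patch_base :: "real ^ 'n \<Rightarrow> 'n mink \<times> real" where
  "patch_base y = (lc_chart_inv \<epsilon> (snd (\<sigma> y)), snd (fst (\<sigma> y)))"

definition patch_covec :: "real ^ 'n \<Rightarrow> 'n covec" where
  "patch_covec y = height_covec X \<epsilon> (\<sigma> y)"

lemma \<sigma>_image: "\<sigma> ` B \<subseteq> chart_domain U I"
  using \<sigma>_domain by blast

lemma smooth_patch_base: "smooth_on B patch_base"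
  unfolding patch_base_def
  by (rule smooth_on_Pair[OF B
        smooth_on_compose[OF B open_chart_domain[OF ws eps] \<sigma>_image \<sigma> smooth_lc_chart_inv[OF ws eps]]
        smooth_on_linear[OF B bounded_linear_snd smooth_on_linear[OF B bounded_linear_fst \<sigma>]]])

lemma smooth_patch_covec: "smooth_on B patch_covec"
  unfolding patch_covec_def
  by (rule smooth_on_compose[OF B open_chart_domain[OF ws eps] \<sigma>_image \<sigma> smooth_height_covec[OF ws eps]])

lemma patch_base_mem:
  assumes "y \<in> B"
  shows "patch_base y \<in> LC \<times> I"
  using \<sigma>_domain[OF assms] lc_chart_inv_LC[OF eps, of "snd (\<sigma> y)"] by (auto simp: patch_base_def)

lemma patch_radial: "radial_value (patch_base y, patch_covec y) = - fst (fst (patch_base y))"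
  unfolding patch_base_def patch_covec_def radial_value_height_covec[OF ws eps]
  by (simp add: lc_chart_inv_def)

lemma der_patch_base:
  assumes y: "y \<in> B"
  shows "snd (fst (D patch_base y w)) = snd (D \<sigma> y w)" "snd (D patch_base y w) = snd (fst (D \<sigma> y w))"
proof -
  note m = smooth_on_imp_has_derivative[OF smooth_patch_base y]
  note s = smooth_on_imp_has_derivative[OF \<sigma> y]
  have "(\<lambda>w. snd (fst (D patch_base y w))) = (\<lambda>w. snd (D \<sigma> y w))"
    by (rule has_derivative_cong_open[OF B y _ has_derivative_snd[OF has_derivative_fst[OF m]]
          has_derivative_snd[OF s]]) (simp add: patch_base_def lc_chart_inv_def)
  then show "snd (fst (D patch_base y w)) = snd (D \<sigma> y w)" by (rule fun_cong)
  have "(\<lambda>w. snd (D patch_base y w)) = (\<lambda>w. snd (fst (D \<sigma> y w)))"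
    by (rule has_derivative_cong_open[OF B y _ has_derivative_snd[OF m]
          has_derivative_snd[OF has_derivative_fst[OF s]]]) (simp add: patch_base_def)
  then show "snd (D patch_base y w) = snd (fst (D \<sigma> y w))" by (rule fun_cong)
qed

lemma der_height_along_patch:
  assumes y: "y \<in> B"
  shows "lprod (D X (fst (\<sigma> y)) (fst (D \<sigma> y w))) (1, lc_dir \<epsilon> (snd (\<sigma> y))) +
    height_grad X \<epsilon> (\<sigma> y) \<bullet> snd (D \<sigma> y w) = 0"
proof -
  have "height_chart X \<epsilon> (\<sigma> x) = 0" if "x \<in> B" for x
    using \<sigma>_constraint[OF that] by (simp add: height_constraint_def zero_prod_def)
  from has_derivative_cong_open[OF B y this has_derivative_compose[OF
      smooth_on_imp_has_derivative[OF \<sigma> y] der_height_chart[OF ws eps \<sigma>_domain[OF y]]]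
      has_derivative_const]
  show ?thesis by (rule fun_cong)
qed

lemma patch_contact:
  assumes y: "y \<in> B"
  shows "covec_apply (patch_covec y) (D patch_base y w) = 0"
proof -
  define a where "a = fst (fst (D \<sigma> y w))"
  define \<tau> where "\<tau> = snd (fst (D \<sigma> y w))"
  define l where "l = (1 :: real, lc_dir \<epsilon> (snd (\<sigma> y)))"
  have z: "fst (\<sigma> y) \<in> U \<times> I" using \<sigma>_domain[OF y] by auto
  note lin = linear_DX[OF ws z]
  have "fst (D \<sigma> y w) = (a, 0) + \<tau> *\<^sub>R (0, 1)"
    by (simp add: a_def \<tau>_def prod_eq_iff)
  then have "D X (fst (\<sigma> y)) (fst (D \<sigma> y w)) =
      D X (fst (\<sigma> y)) (a, 0) + \<tau> *\<^sub>R D X (fst (\<sigma> y)) (0, 1)"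
    by (simp only: linear_add[OF lin] linear_scale[OF lin])
  moreover have "lprod (D X (fst (\<sigma> y)) (a, 0)) l = 0"
    unfolding l_def by (rule slice_constraint[OF ws eps \<sigma>_domain[OF y] \<sigma>_constraint[OF y]])
  ultimately have "lprod (D X (fst (\<sigma> y)) (fst (D \<sigma> y w))) l = lprod (D X (fst (\<sigma> y)) (0, 1)) l * \<tau>"
    by (simp add: lprod.add_left lprod.scaleR_left)
  with der_height_along_patch[OF y, of w] show ?thesis
    unfolding covec_apply_def der_patch_base[OF y]
    by (simp add: patch_covec_def height_covec_def inner_vec_def l_def \<tau>_def)
qed

text \<open>Fixing the base point leaves only a displacement \<open>a\<close> in \<open>u\<close>. The height gradient sees \<open>X\<close> up to
  multiples of \<open>\<omega>\<close>, so \<open>D X (a, 0)\<close> has spatial part parallel to \<open>\<omega>\<close>, and it is orthogonal to the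
  null vector \<open>(1, \<omega>)\<close>.\<close>

lemma patch_immersion:
  assumes y: "y \<in> B" and m: "D patch_base y w = 0" and \<alpha>: "D patch_covec y w = 0"
  shows "w = 0"
proof -
  define p where "p = \<sigma> y"
  have p: "p \<in> chart_domain U I" "height_constraint X \<epsilon> p = 0"
    using \<sigma>_domain[OF y] \<sigma>_constraint[OF y] by (simp_all add: p_def)
  then have z: "fst p \<in> U \<times> I" and x: "snd p \<noteq> 0" by auto
  define a where "a = fst (fst (D \<sigma> y w))"
  define Y where "Y = D X (fst p) (a, 0)"
  define \<omega> where "\<omega> = lc_dir \<epsilon> (snd p)"
  have s: "D \<sigma> y w = ((a, 0), 0)"
    using der_patch_base[OF y, of w] m by (simp add: a_def prod_eq_iff)
  note d\<sigma> = smooth_on_imp_has_derivative[OF \<sigma> y]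
  have "((\<lambda>y. fst (patch_covec y)) has_derivative (\<lambda>w. fst (D patch_covec y w))) (at y)"
    by (rule has_derivative_fst[OF smooth_on_imp_has_derivative[OF smooth_patch_covec y]])
  moreover have "((\<lambda>y. height_grad X \<epsilon> (\<sigma> y)) has_derivative (\<lambda>w. D (height_grad X \<epsilon>) p (D \<sigma> y w))) (at y)"
    unfolding p_def
    by (rule has_derivative_compose[OF d\<sigma> smooth_on_imp_has_derivative[OF smooth_height_grad[OF ws eps]
            \<sigma>_domain[OF y]]])
  ultimately have "(\<lambda>w. fst (D patch_covec y w)) = (\<lambda>w. D (height_grad X \<epsilon>) p (D \<sigma> y w))"
    by (rule has_derivative_cong_open[OF B y, rotated 1]) (simp add: patch_covec_def height_covec_def)
  from fun_cong[OF this, of w] have "D (height_grad X \<epsilon>) p ((a, 0), 0) = 0"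
    using \<alpha> s by simp
  then have "snd Y = (snd Y \<bullet> \<omega>) *\<^sub>R \<omega>"
    using x eps unfolding der_height_grad_slice[OF p(1)] Y_def \<omega>_def by auto
  then have "snd Y \<bullet> snd Y = (snd Y \<bullet> \<omega>) * (snd Y \<bullet> \<omega>)"
    by (metis inner_scaleR_right)
  moreover have "lprod Y (1, \<omega>) = 0"
    unfolding Y_def \<omega>_def by (rule slice_constraint[OF ws eps p])
  ultimately have "a = 0"
    unfolding Y_def by (intro slice_projection_zero[OF ws eps z])
  then have "D \<sigma> y w = 0" using s by (simp add: zero_prod_def)
  moreover have "(\<lambda>w. P (D \<sigma> y w)) = (\<lambda>w. w)"
    by (rule has_derivative_cong_open[OF B y P\<sigma> bounded_linear.has_derivative[OF P d\<sigma>] has_derivative_ident])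
  ultimately show "w = 0"
    using fun_cong[of "\<lambda>w. P (D \<sigma> y w)" "\<lambda>w. w" w] linear_0[OF bounded_linear.linear[OF P]] by simp
qed

text \<open>With the base point held fixed the value of the covector on the radial direction cannot change to
  first order, while scaling the covector would change it. So a derivative
  that is a multiple of the covector is zero.\<close>

lemma patch_projective_immersion:
  assumes y: "y \<in> B" and m: "D patch_base y w = 0" and \<alpha>: "D patch_covec y w \<in> span {patch_covec y}"
  shows "w = 0"
proof -
  obtain c where c: "D patch_covec y w = c *\<^sub>R patch_covec y"
    using \<alpha> by (auto simp: span_singleton)
  note dm = smooth_on_imp_has_derivative[OF smooth_patch_base y]
    and da = smooth_on_imp_has_derivative[OF smooth_patch_covec y]
  have "fst (patch_covec x) \<bullet> snd (fst (patch_base x)) = - fst (fst (patch_base x))" for x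
    using patch_radial[of x] by (simp add: radial_value_def)
  from has_derivative_cong_open[OF B y this has_derivative_inner[OF has_derivative_fst[OF da]
        has_derivative_snd[OF has_derivative_fst[OF dm]]] has_derivative_minus[OF has_derivative_fst[OF has_derivative_fst[OF dm]]]]
  have "fst (patch_covec y) \<bullet> snd (fst (D patch_base y w)) + fst (D patch_covec y w) \<bullet> snd (fst (patch_base y)) =
      - fst (fst (D patch_base y w))"
    by (rule fun_cong)
  then have "c * radial_value (patch_base y, patch_covec y) = 0"
    by (simp add: m c radial_value_def)
  moreover have "fst (fst (patch_base y)) \<noteq> 0"
    using patch_base_mem[OF y] by (auto simp: LC_def)
  ultimately have "c = 0" by (simp add: patch_radial)
  then show ?thesis
    using patch_immersion[OF y m] c by simp
qed

end

end

section \<open>The big wave front\<close>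

text \<open>An immersion is locally an embedding, and with a left inverse \<open>h\<close> of its derivative this is
  detected by the local diffeomorphism \<open>h \<circ> f\<close>.\<close>

lemma immersion_linear_chart:
  fixes f :: "'a::euclidean_space \<Rightarrow> 'b::euclidean_space"
  assumes "open S" "smooth_on S f" "y0 \<in> S" "inj (D f y0)"
  obtains B and h :: "'b \<Rightarrow> 'a" where "open B" "B \<subseteq> S" "y0 \<in> B" "bounded_linear h" "inj_on (\<lambda>y. h (f y)) B"
    "\<And>T. openin (top_of_set B) T \<Longrightarrow> open ((\<lambda>y. h (f y)) ` T)"
proof -
  note der = smooth_on_imp_has_derivative[OF assms(2,3)]
  obtain h where h: "linear h" "h \<circ> D f y0 = id"
    using linear_injective_left_inverse[OF has_derivative_linear[OF der] assms(4)] by blast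
  then have bl: "bounded_linear h" by (simp add: linear_conv_bounded_linear)
  have "D (\<lambda>y. h (f y)) y0 = (\<lambda>w. h (D f y0 w))"
    by (rule frechet_derivative_at[OF bounded_linear.has_derivative[OF bl der], symmetric])
  also have "\<dots> = id" using h(2) by (simp add: comp_def)
  finally have "inj (D (\<lambda>y. h (f y)) y0)" by simp
  then obtain B V g where B: "open B" "B \<subseteq> S" "y0 \<in> B" "open V" "homeomorphism B V (\<lambda>y. h (f y)) g"
    by (rule smooth_inverse_function[OF assms(1) smooth_on_linear[OF assms(1) bl assms(2)] assms(3)])
  have "inj_on (\<lambda>y. h (f y)) B"
    by (rule inj_on_inverseI[where g = g]) (use B(5) in \<open>simp add: homeomorphism_def\<close>)
  moreover have "open ((\<lambda>y. h (f y)) ` T)" if "openin (top_of_set B) T" for T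
    by (rule openin_open_trans[OF homeomorphism_imp_open_map[OF B(5) that] B(4)])
  ultimately show ?thesis
    by (rule that[OF B(1-3) bl])
qed

text \<open>All choices are made near the given point: the component of the cone (the sign \<open>\<epsilon>\<close>), the
  coordinates \<open>P\<close> on the zero set, and a patch so small that the lift is an embedding there. The
  neighbourhood cuts out of \<^const>\<open>Sigma_star\<close> exactly the points of the patch, so a single
  Legendrian patch covers the image.\<close>

lemma big_legendrian_at:
  fixes X :: "(real ^ 's::finite) \<times> real \<Rightarrow> 'n::finite mink"
  assumes ws: "world_sheet X U I" and s0: "s0 \<in> Sigma_star X U I"
  obtains V where "open V" "s0 \<in> V"
    "embedding_map (top_of_set (Sigma_star X U I \<inter> V)) (pt_topology I) (legendrian_lift X)"
    "legendrian_submanifold I (legendrian_lift X ` (Sigma_star X U I \<inter> V))"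
proof -
  let ?S = "Sigma_star X U I"
  define j :: "(real ^ 's) \<times> 'n mink \<times> real \<Rightarrow> ('s, 'n) chart_point"
    where "j = (\<lambda>s. ((fst s, snd (snd s)), snd (fst (snd s))))"
  define \<epsilon> where "\<epsilon> = sgn (fst (fst (snd s0)))"
  have S_LC: "fst (snd s) \<in> LC" if "s \<in> ?S" for s
    using that mem_Sigma_star_iff[OF ws, of "fst s" "fst (snd s)" "snd (snd s)"] by simp
  have LC_snd: "snd v \<noteq> 0" if "v \<in> LC" for v :: "'n mink"
    using that by (auto simp: LC_def lprod_self)
  have eps: "\<epsilon> = 1 \<or> \<epsilon> = -1"
    using S_LC[OF s0] by (auto simp: \<epsilon>_def LC_def sgn_if)
  have j_unchart: "j (unchart \<epsilon> p) = p" for p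
    by (simp add: j_def unchart_def lc_chart_inv_def)
  have unchart_j: "unchart \<epsilon> (j s) = s" if "s \<in> ?S" "\<epsilon> * fst (fst (snd s)) > 0" for s
  proof -
    have "sgn (fst (fst (snd s))) = \<epsilon>"
      using that(2) eps by (auto simp: sgn_if zero_less_mult_iff)
    then show ?thesis
      using lc_chart_inv_snd[OF S_LC[OF that(1)]] by (simp add: unchart_def j_def)
  qed
  have j_S: "j s \<in> chart_domain U I" "height_constraint X \<epsilon> (j s) = 0"
    if "s \<in> ?S" "\<epsilon> * fst (fst (snd s)) > 0" for s
    using unchart_mem_Sigma_star_iff[OF ws eps, of "j s"] unchart_j[OF that] that(1)
      LC_snd[OF S_LC[OF that(1)]] by (simp_all add: j_def)
  have pos0: "\<epsilon> * fst (fst (snd s0)) > 0"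
    using S_LC[OF s0] by (auto simp: \<epsilon>_def LC_def sgn_if)
  define p0 where "p0 = j s0"
  note p0 = j_S[OF s0 pos0, folded p0_def]

  \<comment> \<open>Complete the constraints to a local diffeomorphism \<open>\<Psi>\<close>; the zero set of the constraints is
    then parametrized by the remaining coordinates \<open>P\<close>.\<close>
  note smooth_c = smooth_height_constraint[OF ws eps]
  note der_c = smooth_on_imp_has_derivative[OF smooth_c p0(1)]
  obtain P :: "('s, 'n) chart_point \<Rightarrow> real ^ 'n"
    where P: "linear P" "inj (\<lambda>w. (D (height_constraint X \<epsilon>) p0 w, P w))"
    by (rule linear_surj_completion[OF has_derivative_linear[OF der_c]
          surj_der_height_constraint[OF ws eps p0], where 'c = "real ^ 'n"]) simp
  have blP: "bounded_linear P" using P(1) by (simp add: linear_conv_bounded_linear)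
  define \<Psi> where "\<Psi> = (\<lambda>p. (height_constraint X \<epsilon> p, P p))"
  note open_dom = open_chart_domain[OF ws eps]
  have smooth_\<Psi>: "smooth_on (chart_domain U I) \<Psi>"
    unfolding \<Psi>_def
    by (rule smooth_on_Pair[OF open_dom smooth_c smooth_on_linear[OF open_dom blP smooth_on_id[OF open_dom]]])
  have "(\<Psi> has_derivative (\<lambda>w. (D (height_constraint X \<epsilon>) p0 w, P w))) (at p0)"
    unfolding \<Psi>_def
    by (rule has_derivative_Pair[OF der_c bounded_linear.has_derivative[OF blP has_derivative_ident]])
  from frechet_derivative_at[OF this] P(2) have "inj (D \<Psi> p0)" by simp
  then obtain W V g where W: "open W" "W \<subseteq> chart_domain U I" "p0 \<in> W" "open V"
    "homeomorphism W V \<Psi> g" "smooth_on V g"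
    by (rule smooth_inverse_function[OF open_dom smooth_\<Psi> p0(1)])
  define B1 where "B1 = {y. (0, y) \<in> V}"
  define \<sigma> where "\<sigma> = (\<lambda>y. g (0, y))"
  have "continuous_on UNIV (\<lambda>y :: real ^ 'n. (0 :: (real ^ 's) \<times> real, y))"
    by (intro continuous_intros)
  then have B1: "open B1"
    using open_vimage[OF W(4), of "\<lambda>y. (0, y)"] by (simp add: B1_def vimage_def)
  have smooth_\<sigma>: "smooth_on B1 \<sigma>"
    unfolding \<sigma>_def
    by (rule smooth_on_compose[OF B1 W(4) _ smooth_on_Pair[OF B1 smooth_on_const smooth_on_id[OF B1]] W(6)])
       (auto simp: B1_def)
  have \<sigma>_W: "\<sigma> y \<in> W" and \<Psi>\<sigma>: "\<Psi> (\<sigma> y) = (0, y)" if "y \<in> B1" for y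
    using that W(5) by (auto simp: B1_def \<sigma>_def homeomorphism_def)
  have \<sigma>P: "\<sigma> (P p) = p" "P p \<in> B1" if "p \<in> W" "height_constraint X \<epsilon> p = 0" for p
  proof -
    have eq: "\<Psi> p = (0, P p)" using that(2) by (simp add: \<Psi>_def)
    have "\<Psi> p \<in> V" "g (\<Psi> p) = p"
      using that(1) W(5) by (auto simp: homeomorphism_def)
    then show "\<sigma> (P p) = p" "P p \<in> B1"
      by (simp_all add: \<sigma>_def B1_def eq)
  qed
  define y0 where "y0 = P p0"
  have y0: "y0 \<in> B1" unfolding y0_def by (rule \<sigma>P(2)[OF W(3) p0(2)])
  have dom: "\<sigma> y \<in> chart_domain U I" and con: "height_constraint X \<epsilon> (\<sigma> y) = 0" and P\<sigma>: "P (\<sigma> y) = y"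
    if "y \<in> B1" for y
    using \<sigma>_W[OF that] \<Psi>\<sigma>[OF that] W(2) by (auto simp: \<Psi>_def)

  \<comment> \<open>Shrink the patch until the lift becomes an embedding.\<close>
  let ?m = "patch_base \<epsilon> \<sigma>" and ?\<alpha> = "patch_covec X \<epsilon> \<sigma>"
  let ?f = "\<lambda>y. (?m y, ?\<alpha> y)"
  have smooth_m: "smooth_on B1 ?m"
    by (rule smooth_patch_base[OF ws eps B1 smooth_\<sigma> blP dom con P\<sigma>])
  have smooth_\<alpha>: "smooth_on B1 ?\<alpha>"
    by (rule smooth_patch_covec[OF ws eps B1 smooth_\<sigma> blP dom con P\<sigma>])
  have smooth_f: "smooth_on B1 ?f"
    by (rule smooth_on_Pair[OF B1 smooth_m smooth_\<alpha>])
  have "D ?f y0 = (\<lambda>w. (D ?m y0 w, D ?\<alpha> y0 w))"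
    by (rule frechet_derivative_at[OF has_derivative_Pair[OF smooth_on_imp_has_derivative[OF smooth_m y0]
            smooth_on_imp_has_derivative[OF smooth_\<alpha> y0]], symmetric])
  then have "w = 0" if "D ?f y0 w = 0" for w
    using that patch_immersion[OF ws eps B1 smooth_\<sigma> blP dom con P\<sigma> y0] by (simp add: zero_prod_def)
  then have "inj (D ?f y0)"
    unfolding linear_injective_0[OF has_derivative_linear[OF smooth_on_imp_has_derivative[OF smooth_f y0]]]
    by blast
  then obtain B and h :: "('n mink \<times> real) \<times> 'n covec \<Rightarrow> real ^ 'n"
    where B: "open B" "B \<subseteq> B1" "y0 \<in> B" and h: "bounded_linear h"
    "inj_on (\<lambda>y. h (?f y)) B" "\<And>T. openin (top_of_set B) T \<Longrightarrow> open ((\<lambda>y. h (?f y)) ` T)"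
    by (rule immersion_linear_chart[OF B1 smooth_f y0]) (rule that, assumption+)
  have smooth_\<sigma>B: "smooth_on B \<sigma>"
    by (rule smooth_on_subset[OF smooth_\<sigma> B(2)])
  have domB: "\<sigma> y \<in> chart_domain U I" and conB: "height_constraint X \<epsilon> (\<sigma> y) = 0"
    and P\<sigma>B: "P (\<sigma> y) = y" if "y \<in> B" for y
    using dom con P\<sigma> that B(2) by auto
  note patch = ws eps B(1) smooth_\<sigma>B blP domB conB P\<sigma>B
  note smooth_mB = smooth_patch_base[OF patch] and smooth_\<alpha>B = smooth_patch_covec[OF patch]
  have mem: "?m y \<in> LC \<times> I" if "y \<in> B" for y
    by (rule patch_base_mem[OF patch that])
  have radial: "radial_value (?m y, ?\<alpha> y) = - fst (fst (?m y))" for y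
    by (rule patch_radial[OF patch])
  have nonzero: "?\<alpha> y \<noteq> 0" if "y \<in> B" for y
    using radial[of y] mem[OF that] by (auto simp: radial_value_def LC_def)
  define \<phi> where "\<phi> = (\<lambda>y. (?m y, proj_class (?\<alpha> y)))"
  have emb_\<phi>: "embedding_map (top_of_set B) (pt_topology I) \<phi>"
    unfolding \<phi>_def
    by (rule embedding_map_projectivization[OF smooth_on_imp_continuous_on[OF smooth_mB]
          smooth_on_imp_continuous_on[OF smooth_\<alpha>B] mem radial linear_continuous_on[OF h(1)] h(2,3)])
  have leg: "legendrian_patch I B ?m ?\<alpha>"
    unfolding legendrian_patch_def
  proof (intro conjI ballI allI impI)
    show "embedding_map (top_of_set B) (pt_topology I) (\<lambda>y. (?m y, proj_class (?\<alpha> y)))"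
      using emb_\<phi> by (simp add: \<phi>_def)
    fix y w
    assume y: "y \<in> B"
    show "covec_apply (?\<alpha> y) (D ?m y w) = 0"
      by (rule patch_contact[OF patch y])
    assume "D ?m y w = 0 \<and> D ?\<alpha> y w \<in> span {?\<alpha> y}"
    then show "w = 0"
      by (elim conjE) (rule patch_projective_immersion[OF patch y])
  qed (use B(1) smooth_mB smooth_\<alpha>B mem nonzero in auto)

  \<comment> \<open>The patch fills the part of the zero set near \<open>s0\<close>.\<close>
  define N where "N = j -` (W \<inter> P -` B) \<inter> {s. \<epsilon> * fst (fst (snd s)) > 0}"
  have cont_j: "continuous_on A j" for A
    unfolding j_def by (intro continuous_intros)
  have cont_P: "continuous_on A P" for A
    by (rule linear_continuous_on[OF blP])
  have "open N"
  proof -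
    have "open (P -` B)"
      by (rule open_vimage[OF B(1) cont_P])
    then have "open (j -` (W \<inter> P -` B))"
      by (intro open_vimage[OF _ cont_j] open_Int W(1))
    moreover have "open {s :: (real ^ 's) \<times> 'n mink \<times> real. \<epsilon> * fst (fst (snd s)) > 0}"
      by (intro open_Collect_less continuous_intros)
    ultimately show ?thesis
      unfolding N_def by (rule open_Int)
  qed
  have "s0 \<in> N"
    using W(3) B(3) pos0 by (simp add: N_def p0_def[symmetric] y0_def[symmetric])
  have to_B: "P (j s) \<in> B" "unchart \<epsilon> (\<sigma> (P (j s))) = s" if "s \<in> ?S \<inter> N" for s
  proof -
    have s: "s \<in> ?S" "\<epsilon> * fst (fst (snd s)) > 0" "j s \<in> W" "P (j s) \<in> B"
      using that by (auto simp: N_def)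
    show "P (j s) \<in> B" by (rule s(4))
    show "unchart \<epsilon> (\<sigma> (P (j s))) = s"
      using \<sigma>P(1)[OF s(3) j_S(2)[OF s(1,2)]] unchart_j[OF s(1,2)] by simp
  qed
  have from_B: "unchart \<epsilon> (\<sigma> y) \<in> ?S \<inter> N" "P (j (unchart \<epsilon> (\<sigma> y))) = y" if "y \<in> B" for y
  proof -
    have x: "snd (\<sigma> y) \<noteq> 0" using domB[OF that] by auto
    have "unchart \<epsilon> (\<sigma> y) \<in> ?S"
      using unchart_mem_Sigma_star_iff[OF ws eps x] domB[OF that] conB[OF that] by simp
    moreover have "\<epsilon> * fst (fst (snd (unchart \<epsilon> (\<sigma> y)))) > 0"
      using eps x by (auto simp: unchart_def lc_chart_inv_def)
    moreover have "\<sigma> y \<in> W" using \<sigma>_W that B(2) by auto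
    ultimately show "unchart \<epsilon> (\<sigma> y) \<in> ?S \<inter> N"
      using that P\<sigma>B[OF that] by (simp add: N_def j_unchart)
    show "P (j (unchart \<epsilon> (\<sigma> y))) = y" by (simp add: j_unchart P\<sigma>B[OF that])
  qed
  have lift_\<sigma>: "legendrian_lift X (unchart \<epsilon> (\<sigma> y)) = \<phi> y" if "y \<in> B" for y
    using legendrian_lift_unchart[OF ws eps domB[OF that]]
    by (simp add: \<phi>_def patch_base_def[OF patch] patch_covec_def[OF patch])
  have lift_j: "legendrian_lift X s = \<phi> (P (j s))" if "s \<in> ?S \<inter> N" for s
    using lift_\<sigma>[OF to_B(1)[OF that]] to_B(2)[OF that] by simp
  have image_B: "(\<lambda>s. P (j s)) ` (?S \<inter> N) = B"
    using to_B(1) from_B by (auto simp: image_iff) (metis from_B)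
  have "continuous_on (?S \<inter> N) (\<lambda>s. P (j s))"
    by (rule continuous_on_compose2[OF cont_P cont_j subset_UNIV])
  moreover have "continuous_on B (\<lambda>y. unchart \<epsilon> (\<sigma> y))"
  proof -
    have "continuous_on A (unchart \<epsilon> :: ('s, 'n) chart_point \<Rightarrow> _)" for A
      unfolding unchart_def lc_chart_inv_def by (intro continuous_intros)
    then show ?thesis
      by (rule continuous_on_compose2[OF _ smooth_on_imp_continuous_on[OF smooth_\<sigma>B] subset_UNIV])
  qed
  ultimately have "homeomorphic_maps (top_of_set (?S \<inter> N)) (top_of_set B)
      (\<lambda>s. P (j s)) (\<lambda>y. unchart \<epsilon> (\<sigma> y))"
    unfolding homeomorphic_maps_def using to_B from_B by auto
  then have "homeomorphic_map (top_of_set (?S \<inter> N)) (top_of_set B) (\<lambda>s. P (j s))"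
    unfolding homeomorphic_map_maps by blast
  then have "embedding_map (top_of_set (?S \<inter> N)) (top_of_set B) (\<lambda>s. P (j s))"
    unfolding embedding_map_def by (simp add: image_B subtopology_subtopology)
  from embedding_map_compose[OF this emb_\<phi>]
  have emb: "embedding_map (top_of_set (?S \<inter> N)) (pt_topology I) (legendrian_lift X)"
    by (rule embedding_map_eq) (simp add: lift_j)
  have image_\<phi>: "legendrian_lift X ` (?S \<inter> N) = \<phi> ` B"
  proof -
    have "legendrian_lift X ` (?S \<inter> N) = \<phi> ` (\<lambda>s. P (j s)) ` (?S \<inter> N)"
      by (simp add: image_image lift_j)
    then show ?thesis by (simp only: image_B)
  qed
  have "\<phi> ` B \<subseteq> PT I"
    unfolding \<phi>_def by (intro image_subsetI PT_I mem nonzero)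
  then have "openin (subtopology (pt_topology I) (\<phi> ` B)) (\<phi> ` B)"
    by (simp add: openin_subtopology_refl topspace_pt_topology)
  then have "legendrian_submanifold I (\<phi> ` B)"
    unfolding legendrian_submanifold_def using leg \<open>\<phi> ` B \<subseteq> PT I\<close> unfolding \<phi>_def by blast
  with that[OF \<open>open N\<close> \<open>s0 \<in> N\<close> emb] image_\<phi> show ?thesis by simp
qed

theorem mainTheorem2:
  fixes X :: "(real ^ 's::finite) \<times> real \<Rightarrow> real \<times> (real ^ 'n::finite)"
    and U :: "(real ^ 's) set" and I :: "real set" and k :: nat
  assumes "k \<ge> 2" and "CARD('s) + k = CARD('n) + 1"
    and "world_sheet X U I"
  shows "big_legendrian I (legendrian_lift X) (Sigma_star X U I) \<and>
    pt_proj ` legendrian_lift X ` Sigma_star X U I =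
      unfolded_pedal X ` N1 X U I \<inter> (LC \<times> I) \<and>
    ((\<forall>q\<in>N1 X U I. pedal_coeff X q \<noteq> 0) \<longrightarrow>
      pt_proj ` legendrian_lift X ` Sigma_star X U I = unfolded_pedal X ` N1 X U I \<and>
      unfolded_pedal X ` N1 X U I \<subseteq> LC \<times> I)"
proof (intro conjI impI)
  show "big_legendrian I (legendrian_lift X) (Sigma_star X U I)"
    unfolding big_legendrian_def by (meson big_legendrian_at[OF assms(3)])
  show front: "pt_proj ` legendrian_lift X ` Sigma_star X U I =
      unfolded_pedal X ` N1 X U I \<inter> (LC \<times> I)"
    by (rule front_eq_pedal_image[OF assms(3)])
  assume coeff: "\<forall>q\<in>N1 X U I. pedal_coeff X q \<noteq> 0"
  show sub: "unfolded_pedal X ` N1 X U I \<subseteq> LC \<times> I"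
  proof (intro image_subsetI)
    fix q
    assume q: "q \<in> N1 X U I"
    then have "momentary_pedal X q \<in> LC"
      using momentary_pedal_LC_iff[OF assms(3) q] coeff by blast
    with q show "unfolded_pedal X q \<in> LC \<times> I"
      by (auto simp: unfolded_pedal_def N1_def)
  qed
  then show "pt_proj ` legendrian_lift X ` Sigma_star X U I = unfolded_pedal X ` N1 X U I"
    unfolding front by blast
qed

end
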